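(* The absolute Galois group and its first cohomology with $\mathbb{F}_p$-coefficients are topological conjugacy invariants of irreducible SFTs: if $X$ and $X'$ are topologically conjugate irreducible SFTs, then $G_X$ and $G_{X'}$ are isomorphic as topological groups, and for every prime $p$ the $\mathbb{F}_p$-vector spaces $H^1(G_X,\mathbb{F}_p)$ and $H^1(G_{X'},\mathbb{F}_p)$ are isomorphic.
   Context: A shift space over a finite alphabet $\mathcal{A}$ is a nonempty closed shift-invariant subset $X\subseteq\mathcal{A}^{\mathbb{Z}}$ (product topology), with shift map $\sigma_X$. It is a shift of finite type (SFT) if it is defined by a finite set of forbidden words, and irreducible if for all words $u,v$ occurring in points of $X$ there is a nonempty word $w$ with $uwv$ occurring in a point of $X$. A sliding block code is a continuous shift-commuting map; a factor map is a surjective one; a topological conjugacy is a bijective one; $\mathrm{Aut}(X)$ is the group of topological conjugacies $X\to X$. For irreducible SFTs $X,Y$, a factor map $\varpi:Y\to X$ is unramified if there is an integer $d\ge1$ with $|\varpi^{-1}(x)|=d$ for all $x\in X$; $\deg(\varpi)=d$. Put $\mathrm{Aut}(Y/X,\varpi)=\{\varphi\in\mathrm{Aut}(Y)\mid\varpi\circ\varphi=\varpi\}$. The map $\varpi$ is a Galois factor if it is unramified and $|\mathrm{Aut}(Y/X,\varpi)|=\deg(\varpi)$; then $\mathrm{Gal}(Y/X,\varpi):=\mathrm{Aut}(Y/X,\varpi)$. Absolute Galois group. Let $X$ be an irreducible SFT and $x_0\in X$. A pointed Galois factor over $(X,x_0)$ is a triple $(Y,y_0,\varpi)$ with $Y$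 an irreducible SFT, $y_0\in Y$ and $\varpi:Y\to X$ a Galois factor with $\varpi(y_0)=x_0$. Two of them, $(Y,y_0,\varpi)$ and $(Y',y_0',\varpi')$, are equivalent if there is a topological conjugacy $\gamma:Y\to Y'$ with $\gamma(y_0)=y_0'$ and $\varpi=\varpi'\circ\gamma$; $\mathcal{I}(X,x_0)$ is the set of equivalence classes. Fix a representative $(Y_i,y_{i,0},\varpi_i)$ of each $i\in\mathcal{I}(X,x_0)$ and set $G_i=\mathrm{Gal}(Y_i/X,\varpi_i)$. Write $i\le j$ if there is an unramified factor map $\alpha_{ij}:Y_j\to Y_i$ with $\alpha_{ij}(y_{j,0})=y_{i,0}$ and $\varpi_j=\varpi_i\circ\alpha_{ij}$; such a map is unique, and $\le$ is a directed partial order. For $i\le j$ and $\varphi\in G_j$, $p_{ij}(\varphi)$ is the unique element of $G_i$ with $p_{ij}(\varphi)\circ\alpha_{ij}=\alpha_{ij}\circ\varphi$. The absolute Galois group is the profinite group $G_{X,x_0}=\varprojlim_{i\in\mathcal{I}(X,x_0)}G_i$ with respect to the maps $p_{ij}$ (each $G_i$ discrete). Up to isomorphism of topological groups it does not depend on the representatives or on $x_0$, and is denoted $G_X$. For a prime $p$, $\mathbb{F}_p$ is given the discrete topology and trivial $G_X$-action, so $H^1(G_X,\mathbb{F}_p)=\mathrm{Hom}_{\mathrm{cont}}(G_X,\mathbb{F}_p)$, an $\mathbb{F}_p$-vector space. *)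

theory Defs
  imports
    "HOL-Analysis.Analysis"
    "HOL-Algebra.Bij"
    "HOL-Algebra.Module"
    "HOL-Algebra.Product_Groups"
    "HOL-Number_Theory.Residues"
begin

section \<open>Shift spaces\<close>

definition full_shift :: "'a set \<Rightarrow> (int \<Rightarrow> 'a) topology" where
  "full_shift A = product_topology (\<lambda>_. discrete_topology A) UNIV"

definition shift :: "(int \<Rightarrow> 'a) \<Rightarrow> int \<Rightarrow> 'a" where
  "shift x = (\<lambda>i. x (i + 1))"

definition shift_space :: "'a set \<Rightarrow> (int \<Rightarrow> 'a) set \<Rightarrow> bool" where
  "shift_space A X \<longleftrightarrow> finite A \<and> X \<noteq> {} \<and> closedin (full_shift A) X \<and> shift ` X = X"

text \<open>The subspace topology of a shift space does not depend on the alphabet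
  (\<open>shift_topology_eq\<close> below), so the alphabet is not a parameter here.\<close>

definition shift_topology :: "(int \<Rightarrow> 'a) set \<Rightarrow> (int \<Rightarrow> 'a) topology" where
  "shift_topology X = subtopology (full_shift UNIV) X"

lemma shift_topology_eq:
  assumes "shift_space A X"
  shows "shift_topology X = subtopology (full_shift A) X"
proof -
  have XA: "X \<subseteq> PiE UNIV (\<lambda>_. A)"
    using assms closedin_subset[of "full_shift A" X]
    by (auto simp: shift_space_def full_shift_def)
  have "full_shift A = product_topology (\<lambda>_. subtopology (discrete_topology UNIV) A) UNIV"
    by (simp add: full_shift_def)
  also have "\<dots> = subtopology (full_shift UNIV) (PiE UNIV (\<lambda>_. A))"
    unfolding full_shift_def by (simp only: subtopology_product_topology)
  finally show ?thesis
    using XA by (simp add: shift_topology_def subtopology_subtopology Int_absorb1)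
qed

definition occurs :: "'a list \<Rightarrow> (int \<Rightarrow> 'a) \<Rightarrow> bool" where
  "occurs w x \<longleftrightarrow> (\<exists>i. \<forall>k<length w. x (i + int k) = w ! k)"

definition language :: "(int \<Rightarrow> 'a) set \<Rightarrow> 'a list set" where
  "language X = {w. \<exists>x\<in>X. occurs w x}"

definition sft :: "'a set \<Rightarrow> (int \<Rightarrow> 'a) set \<Rightarrow> bool" where
  "sft A X \<longleftrightarrow> shift_space A X \<and>
     (\<exists>F. finite F \<and> F \<subseteq> lists A \<and> X = {x. range x \<subseteq> A \<and> (\<forall>w\<in>F. \<not> occurs w x)})"

definition irreducible_sft :: "'a set \<Rightarrow> (int \<Rightarrow> 'a) set \<Rightarrow> bool" where
  "irreducible_sft A X \<longleftrightarrow> sft A X \<and>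
     (\<forall>u\<in>language X. \<forall>v\<in>language X. \<exists>w. w \<noteq> [] \<and> u @ w @ v \<in> language X)"

text \<open>A map \<open>Y \<rightarrow> X\<close> is a function that is \<open>undefined\<close> outside \<open>Y\<close>. This makes equality of
  maps the equality of HOL functions, so that sets of maps have the right cardinality.\<close>

definition sliding_block_code ::
    "(int \<Rightarrow> 'a) set \<Rightarrow> (int \<Rightarrow> 'b) set \<Rightarrow> ((int \<Rightarrow> 'a) \<Rightarrow> int \<Rightarrow> 'b) \<Rightarrow> bool" where
  "sliding_block_code Y X f \<longleftrightarrow> f \<in> Y \<rightarrow>\<^sub>E X \<and>
     continuous_map (shift_topology Y) (shift_topology X) f \<and> (\<forall>y\<in>Y. f (shift y) = shift (f y))"

definition factor_map ::
    "(int \<Rightarrow> 'a) set \<Rightarrow> (int \<Rightarrow> 'b) set \<Rightarrow> ((int \<Rightarrow> 'a) \<Rightarrow> int \<Rightarrow> 'b) \<Rightarrow> bool" where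
  "factor_map Y X f \<longleftrightarrow> sliding_block_code Y X f \<and> f ` Y = X"

definition topological_conjugacy ::
    "(int \<Rightarrow> 'a) set \<Rightarrow> (int \<Rightarrow> 'b) set \<Rightarrow> ((int \<Rightarrow> 'a) \<Rightarrow> int \<Rightarrow> 'b) \<Rightarrow> bool" where
  "topological_conjugacy Y X f \<longleftrightarrow> sliding_block_code Y X f \<and> bij_betw f Y X"

definition topologically_conjugate :: "(int \<Rightarrow> 'a) set \<Rightarrow> (int \<Rightarrow> 'b) set \<Rightarrow> bool" where
  "topologically_conjugate X X' \<longleftrightarrow> (\<exists>f. topological_conjugacy X X' f)"

section \<open>Galois factors\<close>

definition has_degree ::
    "(int \<Rightarrow> 'a) set \<Rightarrow> (int \<Rightarrow> 'b) set \<Rightarrow> ((int \<Rightarrow> 'a) \<Rightarrow> int \<Rightarrow> 'b) \<Rightarrow> nat \<Rightarrow> bool" where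
  "has_degree Y X \<pi> d \<longleftrightarrow> d \<ge> 1 \<and> (\<forall>x\<in>X. card {y \<in> Y. \<pi> y = x} = d)"

definition unramified ::
    "(int \<Rightarrow> 'a) set \<Rightarrow> (int \<Rightarrow> 'b) set \<Rightarrow> ((int \<Rightarrow> 'a) \<Rightarrow> int \<Rightarrow> 'b) \<Rightarrow> bool" where
  "unramified Y X \<pi> \<longleftrightarrow> factor_map Y X \<pi> \<and> (\<exists>d. has_degree Y X \<pi> d)"

definition deg ::
    "(int \<Rightarrow> 'a) set \<Rightarrow> (int \<Rightarrow> 'b) set \<Rightarrow> ((int \<Rightarrow> 'a) \<Rightarrow> int \<Rightarrow> 'b) \<Rightarrow> nat" where
  "deg Y X \<pi> = (THE d. has_degree Y X \<pi> d)"

definition Aut_over ::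
    "(int \<Rightarrow> 'a) set \<Rightarrow> ((int \<Rightarrow> 'a) \<Rightarrow> int \<Rightarrow> 'b) \<Rightarrow> ((int \<Rightarrow> 'a) \<Rightarrow> int \<Rightarrow> 'a) set" where
  "Aut_over Y \<pi> = {\<phi>. topological_conjugacy Y Y \<phi> \<and> (\<forall>y\<in>Y. \<pi> (\<phi> y) = \<pi> y)}"

definition galois_factor ::
    "(int \<Rightarrow> 'a) set \<Rightarrow> (int \<Rightarrow> 'b) set \<Rightarrow> ((int \<Rightarrow> 'a) \<Rightarrow> int \<Rightarrow> 'b) \<Rightarrow> bool" where
  "galois_factor Y X \<pi> \<longleftrightarrow> unramified Y X \<pi> \<and> card (Aut_over Y \<pi>) = deg Y X \<pi>"

definition Gal :: "(int \<Rightarrow> 'a) set \<Rightarrow> ((int \<Rightarrow> 'a) \<Rightarrow> int \<Rightarrow> 'b) \<Rightarrow> ((int \<Rightarrow> 'a) \<Rightarrow> int \<Rightarrow> 'a) monoid" where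
  "Gal Y \<pi> = BijGroup Y\<lparr>carrier := Aut_over Y \<pi>\<rparr>"

section \<open>The absolute Galois group\<close>

text \<open>The covering shifts range over all finite alphabets contained in \<open>nat\<close>. Every finite alphabet
  injects into \<open>nat\<close>, so every equivalence class of pointed Galois factors is represented.\<close>

type_synonym 'a pointed_factor =
  "(int \<Rightarrow> nat) set \<times> (int \<Rightarrow> nat) \<times> ((int \<Rightarrow> nat) \<Rightarrow> int \<Rightarrow> 'a)"

abbreviation cover :: "'a pointed_factor \<Rightarrow> (int \<Rightarrow> nat) set" where
  "cover c \<equiv> fst c"

abbreviation basept :: "'a pointed_factor \<Rightarrow> int \<Rightarrow> nat" where
  "basept c \<equiv> fst (snd c)"

abbreviation proj :: "'a pointed_factor \<Rightarrow> (int \<Rightarrow> nat) \<Rightarrow> int \<Rightarrow> 'a" where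
  "proj c \<equiv> snd (snd c)"

definition pointed_galois_factors :: "(int \<Rightarrow> 'a) set \<Rightarrow> (int \<Rightarrow> 'a) \<Rightarrow> 'a pointed_factor set" where
  "pointed_galois_factors X x0 =
     {(Y, y0, \<pi>). (\<exists>B. irreducible_sft B Y) \<and> y0 \<in> Y \<and> galois_factor Y X \<pi> \<and> \<pi> y0 = x0}"

definition pointed_equiv ::
    "(int \<Rightarrow> 'a) set \<Rightarrow> (int \<Rightarrow> 'a) \<Rightarrow> ('a pointed_factor \<times> 'a pointed_factor) set" where
  "pointed_equiv X x0 = {(c, c'). c \<in> pointed_galois_factors X x0 \<and> c' \<in> pointed_galois_factors X x0 \<and>
     (\<exists>\<gamma>. topological_conjugacy (cover c) (cover c') \<gamma> \<and> \<gamma> (basept c) = basept c' \<and>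
        (\<forall>y\<in>cover c. proj c y = proj c' (\<gamma> y)))}"

definition galois_classes :: "(int \<Rightarrow> 'a) set \<Rightarrow> (int \<Rightarrow> 'a) \<Rightarrow> 'a pointed_factor set set" where
  "galois_classes X x0 = pointed_galois_factors X x0 // pointed_equiv X x0"

type_synonym 'a representatives = "'a pointed_factor set \<Rightarrow> 'a pointed_factor"

definition representatives :: "(int \<Rightarrow> 'a) set \<Rightarrow> (int \<Rightarrow> 'a) \<Rightarrow> 'a representatives \<Rightarrow> bool" where
  "representatives X x0 R \<longleftrightarrow> (\<forall>i\<in>galois_classes X x0. R i \<in> i)"

text \<open>\<open>transition c d \<alpha>\<close>: \<open>\<alpha>\<close> is a map from the pointed factor \<open>d\<close> to the pointed factor \<open>c\<close>.\<close>

definition transition ::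
    "'a pointed_factor \<Rightarrow> 'a pointed_factor \<Rightarrow> ((int \<Rightarrow> nat) \<Rightarrow> int \<Rightarrow> nat) \<Rightarrow> bool" where
  "transition c d \<alpha> \<longleftrightarrow> unramified (cover d) (cover c) \<alpha> \<and> \<alpha> (basept d) = basept c \<and>
     (\<forall>y\<in>cover d. proj d y = proj c (\<alpha> y))"

definition class_le ::
    "'a representatives \<Rightarrow> 'a pointed_factor set \<Rightarrow> 'a pointed_factor set \<Rightarrow> bool" where
  "class_le R i j \<longleftrightarrow> (\<exists>\<alpha>. transition (R i) (R j) \<alpha>)"

definition trans_map ::
    "'a representatives \<Rightarrow> 'a pointed_factor set \<Rightarrow> 'a pointed_factor set
      \<Rightarrow> (int \<Rightarrow> nat) \<Rightarrow> int \<Rightarrow> nat" where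
  "trans_map R i j = (THE \<alpha>. transition (R i) (R j) \<alpha>)"

definition Gal_at ::
    "'a representatives \<Rightarrow> 'a pointed_factor set \<Rightarrow> ((int \<Rightarrow> nat) \<Rightarrow> int \<Rightarrow> nat) monoid" where
  "Gal_at R i = Gal (cover (R i)) (proj (R i))"

definition restr_map ::
    "'a representatives \<Rightarrow> 'a pointed_factor set \<Rightarrow> 'a pointed_factor set
      \<Rightarrow> ((int \<Rightarrow> nat) \<Rightarrow> int \<Rightarrow> nat) \<Rightarrow> (int \<Rightarrow> nat) \<Rightarrow> int \<Rightarrow> nat" where
  "restr_map R i j \<phi> = (THE \<psi>. \<psi> \<in> carrier (Gal_at R i) \<and>
     (\<forall>y\<in>cover (R j). \<psi> (trans_map R i j y) = trans_map R i j (\<phi> y)))"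

type_synonym 'a galois_thread = "'a pointed_factor set \<Rightarrow> (int \<Rightarrow> nat) \<Rightarrow> int \<Rightarrow> nat"

definition abs_galois_group ::
    "(int \<Rightarrow> 'a) set \<Rightarrow> (int \<Rightarrow> 'a) \<Rightarrow> 'a representatives \<Rightarrow> 'a galois_thread monoid" where
  "abs_galois_group X x0 R =
     product_group (galois_classes X x0) (Gal_at R)
       \<lparr>carrier := {g \<in> (\<Pi>\<^sub>E i\<in>galois_classes X x0. carrier (Gal_at R i)).
          \<forall>i\<in>galois_classes X x0. \<forall>j\<in>galois_classes X x0.
            class_le R i j \<longrightarrow> restr_map R i j (g j) = g i}\<rparr>"

definition abs_galois_topology ::
    "(int \<Rightarrow> 'a) set \<Rightarrow> (int \<Rightarrow> 'a) \<Rightarrow> 'a representatives \<Rightarrow> 'a galois_thread topology" where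
  "abs_galois_topology X x0 R =
     subtopology
       (product_topology (\<lambda>i. discrete_topology (carrier (Gal_at R i))) (galois_classes X x0))
       (carrier (abs_galois_group X x0 R))"

definition top_group_isomorphic ::
    "('g, 'm) monoid_scheme \<Rightarrow> 'g topology \<Rightarrow> ('h, 'n) monoid_scheme \<Rightarrow> 'h topology \<Rightarrow> bool" where
  "top_group_isomorphic G S H T \<longleftrightarrow> (\<exists>f. f \<in> iso G H \<and> homeomorphic_map S T f)"

section \<open>First cohomology\<close>

text \<open>\<open>H1 p G T\<close> is the vector space of continuous homomorphisms from \<open>(G, T)\<close> to the discrete additive
  group of \<open>residue_ring p\<close>. The fields \<open>mult\<close> and \<open>one\<close> of the record type \<open>module\<close> have no meaning
  for a module.\<close>

definition H1 :: "int \<Rightarrow> ('g, 'm) monoid_scheme \<Rightarrow> 'g topology \<Rightarrow> (int, 'g \<Rightarrow> int) module" where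
  "H1 p G T =
     \<lparr>carrier = {f \<in> extensional (carrier G). f \<in> hom G (add_monoid (residue_ring p)) \<and>
                   continuous_map T (discrete_topology (carrier (residue_ring p))) f},
      monoid.mult = undefined, one = undefined,
      zero = (\<lambda>g\<in>carrier G. \<zero>\<^bsub>residue_ring p\<^esub>),
      add = (\<lambda>f h. \<lambda>g\<in>carrier G. f g \<oplus>\<^bsub>residue_ring p\<^esub> h g),
      smult = (\<lambda>c f. \<lambda>g\<in>carrier G. c \<otimes>\<^bsub>residue_ring p\<^esub> f g)\<rparr>"

definition module_isomorphic ::
    "('r, 'k) ring_scheme \<Rightarrow> ('r, 'v, 'm) module_scheme \<Rightarrow> ('r, 'w, 'n) module_scheme \<Rightarrow> bool" where
  "module_isomorphic K V W \<longleftrightarrow> (\<exists>f. bij_betw f (carrier V) (carrier W) \<and>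
     (\<forall>u\<in>carrier V. \<forall>v\<in>carrier V. f (u \<oplus>\<^bsub>V\<^esub> v) = f u \<oplus>\<^bsub>W\<^esub> f v) \<and>
     (\<forall>c\<in>carrier K. \<forall>v\<in>carrier V. f (c \<odot>\<^bsub>V\<^esub> v) = c \<odot>\<^bsub>W\<^esub> f v))"

end

theory Submission
  imports Defs
begin

text \<open>A constant-to-one factor map between irreducible shifts of finite type separates the points of
  each fibre uniformly, so that left and right asymptotic points lift uniquely. Following
  \<open>x0\<close>, carried over to \<open>X'\<close> by the conjugacy, to a left asymptotic point \<open>t\<close> and then \<open>t\<close> to a right asymptotic translate of \<open>x0'\<close> gives a
  bijection between the fibres over \<open>x0\<close> and \<open>x0'\<close> that is natural in the covering shift. It replaces
  a path between the base points: it moves the base points of all Galois factors at once, compatibly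
  with the transition maps, and so it identifies the two inverse systems without any
  compactness argument. Since a code over the base is determined by its value at one point, the Galois
  group acts simply transitively on fibres, and the restriction maps are determined by
  the transition maps.\<close>

section \<open>Windows and local rules\<close>

text \<open>A conjugacy sends \<open>x0\<close> to some point of \<open>X'\<close>, in general not
  to \<open>x0'\<close>, so every cover also needs a new base point over \<open>x0'\<close>. In a
  single cover any point of the fibre would do, because the Galois group permutes the fibre
  transitively; but points chosen cover by cover need not be related by the transition maps. Tails
  give a coherent choice: a sliding block code has a local rule and hence preserves asymptotic
  pairs, whichever covers it connects. Irreducibility does not control the length of a connecting
  word, which is why \<open>x0'\<close> is reached only up to a translate. The obstacle is
  uniformity. Each fibre is finite, so some window separates its points, but the size of that window
  may depend on the base point. Semicontinuity of the set of windows over a point and the Baire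
  theorem give one size valid on a cylinder; irreducibility and splicing give one size valid
  everywhere. The fibres then vary locally constantly, as in a finite covering, and tails can be
  lifted one coordinate at a time.\<close>

definition agree_on :: "int set \<Rightarrow> (int \<Rightarrow> 'a) \<Rightarrow> (int \<Rightarrow> 'a) \<Rightarrow> bool" where
  "agree_on S x y \<longleftrightarrow> (\<forall>i\<in>S. x i = y i)"

abbreviation agree :: "nat \<Rightarrow> (int \<Rightarrow> 'a) \<Rightarrow> (int \<Rightarrow> 'a) \<Rightarrow> bool" where
  "agree n \<equiv> agree_on {- int n..int n}"

text \<open>\<open>restrict\<close> gives all windows the same value outside the interval, so the
  windows of the points of a fibre form a set of functions that can be counted.\<close>

definition window :: "nat \<Rightarrow> (int \<Rightarrow> 'a) \<Rightarrow> int \<Rightarrow> 'a" where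
  "window n x = restrict x {- int n..int n}"

definition translate :: "int \<Rightarrow> (int \<Rightarrow> 'a) \<Rightarrow> int \<Rightarrow> 'a" where
  "translate n x = (\<lambda>i. x (i + n))"

lemma agree_on_refl [simp]: "agree_on S x x"
  by (simp add: agree_on_def)

lemma agree_on_sym: "agree_on S x y \<Longrightarrow> agree_on S y x"
  by (simp add: agree_on_def)

lemma agree_on_trans: "agree_on S x y \<Longrightarrow> agree_on S y z \<Longrightarrow> agree_on S x z"
  by (simp add: agree_on_def)

lemma agree_on_mono: "agree_on T x y \<Longrightarrow> S \<subseteq> T \<Longrightarrow> agree_on S x y"
  by (auto simp: agree_on_def)

lemma agree_mono: "agree n x y \<Longrightarrow> m \<le> n \<Longrightarrow> agree m x y"
  by (erule agree_on_mono) auto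

lemma agree_iff_window: "agree n x y \<longleftrightarrow> window n x = window n y"
  by (auto simp: agree_on_def window_def fun_eq_iff restrict_def)

lemma agree_translate_iff:
  "agree n (translate k x) (translate k y) \<longleftrightarrow> agree_on {k - int n..k + int n} x y"
proof -
  have "(\<forall>i\<in>{- int n..int n}. x (i + k) = y (i + k)) \<longleftrightarrow> (\<forall>i\<in>{k - int n..k + int n}. x i = y i)"
    (is "?L \<longleftrightarrow> ?R")
  proof
    assume L: ?L
    show ?R
    proof
      fix i assume "i \<in> {k - int n..k + int n}"
      then have "i - k \<in> {- int n..int n}" by auto
      with L have "x ((i - k) + k) = y ((i - k) + k)" by blast
      then show "x i = y i" by simp
    qed
  qed auto
  then show ?thesis by (simp add: agree_on_def translate_def)
qed

lemma translate_0 [simp]: "translate 0 x = x"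
  by (simp add: translate_def)

lemma translate_translate [simp]: "translate m (translate n x) = translate (m + n) x"
  by (simp add: translate_def add.assoc)

lemma shift_eq_translate: "shift x = translate 1 x"
  by (simp add: shift_def translate_def)

lemma translate_in:
  assumes "shift ` X = X" "x \<in> X"
  shows "translate n x \<in> X"
proof (induction n rule: int_induct[where k = 0])
  case base
  then show ?case using assms by simp
next
  case (step1 i)
  have "shift (translate i x) \<in> X" using step1 assms by blast
  then show ?case by (simp add: shift_eq_translate add.commute)
next
  case (step2 i)
  \<comment> \<open>Surjectivity of the shift supplies a predecessor in \<open>X\<close>; this is
    what makes negative translates stay in \<open>X\<close>.\<close>
  then obtain z where "z \<in> X" "shift z = translate i x" using assms by (metis imageE)
  then have "translate (-1) (translate 1 z) = translate (i - 1) x" 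
    by (simp add: shift_eq_translate)
  then show ?case using \<open>z \<in> X\<close> by simp
qed

lemma translate_commute:
  assumes "shift ` Y = Y" and com: "\<And>y. y \<in> Y \<Longrightarrow> f (shift y) = shift (f y)" and "y \<in> Y"
  shows "f (translate n y) = translate n (f y)"
proof (induction n rule: int_induct[where k = 0])
  case base
  then show ?case by simp
next
  case (step1 i)
  have "f (shift (translate i y)) = shift (f (translate i y))"
    by (rule com[OF translate_in[OF assms(1,3)]])
  then show ?case using step1 by (simp add: shift_eq_translate add.commute)
next
  case (step2 i)
  have "f (shift (translate (i - 1) y)) = shift (f (translate (i - 1) y))"
    by (rule com[OF translate_in[OF assms(1,3)]])
  then have "translate (-1) (translate i (f y)) = translate (-1) (translate 1 (f (translate (i - 1) y)))"
    using step2 by (simp add: shift_eq_translate)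
  then show ?case by simp
qed

lemma topspace_shift_topology [simp]: "topspace (shift_topology X) = X"
  by (simp add: shift_topology_def full_shift_def)

text \<open>Cylinders on central windows form a base: a basic open set of the product constrains
  finitely many coordinates, and these lie in one central interval. All later topology is phrased
  through \<open>agree\<close>.\<close>

lemma openin_shift_topology:
  "openin (shift_topology X) U \<longleftrightarrow>
     U \<subseteq> X \<and> (\<forall>x\<in>U. \<exists>n. \<forall>x'\<in>X. agree n x x' \<longrightarrow> x' \<in> U)"
proof
  assume "openin (shift_topology X) U"
  then obtain V where V: "openin (full_shift UNIV) V" "U = V \<inter> X"
    by (auto simp: shift_topology_def openin_subtopology)
  have "\<exists>n. \<forall>x'\<in>X. agree n x x' \<longrightarrow> x' \<in> U" if "x \<in> U" for x
  proof -
    have "x \<in> V" using that V by simp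
    then obtain W where W: "finite {i. W i \<noteq> (UNIV::'a set)}" "x \<in> Pi\<^sub>E UNIV W" "Pi\<^sub>E UNIV W \<subseteq> V"
      using V(1) unfolding full_shift_def openin_product_topology_alt by force
    have "\<exists>n. \<forall>i\<in>{i. W i \<noteq> UNIV}. \<bar>i\<bar> \<le> int n"
    proof -
      obtain M where "\<forall>i\<in>{i. W i \<noteq> UNIV}. \<bar>i\<bar> \<le> M"
        using W(1) by (metis bdd_above.E bdd_above_finite finite_imageI image_eqI)
      then have "\<forall>i\<in>{i. W i \<noteq> UNIV}. \<bar>i\<bar> \<le> int (nat M)"
        by (auto intro: order_trans)
      then show ?thesis by blast
    qed
    then obtain n where n: "\<And>i. W i \<noteq> UNIV \<Longrightarrow> \<bar>i\<bar> \<le> int n" by auto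
    have "x' \<in> U" if "x' \<in> X" "agree n x x'" for x'
    proof -
      have "x' i \<in> W i" for i
      proof (cases "W i = UNIV")
        case False
        then have "i \<in> {- int n..int n}" using n[of i] by auto
        then have "x' i = x i" using that(2) by (simp add: agree_on_def)
        then show ?thesis using W(2) by (auto simp: PiE_iff)
      qed simp
      then show ?thesis using W(3) V(2) that by (auto simp: PiE_iff)
    qed
    then show ?thesis by blast
  qed
  then show "U \<subseteq> X \<and> (\<forall>x\<in>U. \<exists>n. \<forall>x'\<in>X. agree n x x' \<longrightarrow> x' \<in> U)" using V by blast
next
  assume R: "U \<subseteq> X \<and> (\<forall>x\<in>U. \<exists>n. \<forall>x'\<in>X. agree n x x' \<longrightarrow> x' \<in> U)"
  then obtain n where n: "\<And>x x'. x \<in> U \<Longrightarrow> x' \<in> X \<Longrightarrow> agree (n x) x x' \<Longrightarrow> x' \<in> U"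
    by metis
  have op: "openin (full_shift UNIV) {x'. agree m x x'}" for x :: "int \<Rightarrow> 'a" and m
  proof -
    have eq: "{x'. agree m x x'} = Pi\<^sub>E UNIV (\<lambda>i. if i \<in> {- int m..int m} then {x i} else UNIV)"
      by (force simp: agree_on_def PiE_iff split: if_splits)
    have "finite {i. (if i \<in> {- int m..int m} then {x i} else UNIV) \<noteq> UNIV}"
      by (rule finite_subset[of _ "{- int m..int m}"]) auto
    then show ?thesis unfolding eq full_shift_def openin_PiE_gen by simp
  qed
  have "openin (full_shift UNIV) (\<Union>x\<in>U. {x'. agree (n x) x x'})"
    using op by blast
  moreover have "U = (\<Union>x\<in>U. {x'. agree (n x) x x'}) \<inter> X"
    using R n by auto
  ultimately show "openin (shift_topology X) U"
    unfolding shift_topology_def openin_subtopology by blast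
qed

text \<open>Compactness comes from the finite alphabet \<open>A\<close>, hence the passage through
  \<open>shift_topology_eq\<close>; over an infinite type the full shift is not compact.\<close>

lemma compact_shift_topology:
  assumes "shift_space A X"
  shows "compact_space (shift_topology X)"
proof -
  have "compact_space (full_shift A)"
    using assms by (auto simp: full_shift_def compact_space_product_topology compact_space_discrete_topology shift_space_def)
  then have "compactin (full_shift A) X"
    using assms closedin_compact_space by (auto simp: shift_space_def)
  then show ?thesis
    by (simp add: shift_topology_eq[OF assms] compact_space_subtopology)
qed

lemma Hausdorff_shift_topology: "Hausdorff_space (shift_topology X)"
  unfolding shift_topology_def full_shift_def
  by (intro Hausdorff_space_subtopology) (simp add: Hausdorff_space_product_topology)

text \<open>A Lebesgue number argument: finitely many cylinders of local constancy cover
  \<open>X\<close>, and two points that agree to the largest of their radii lie in a common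
  cylinder, where both take the value at its centre. The type of values is arbitrary; the lemma
  serves for a coordinate of a code and for the set of windows of a fibre.\<close>

lemma locally_constant_uniform:
  assumes "shift_space A X"
    and loc: "\<And>x. x \<in> X \<Longrightarrow> \<exists>n. \<forall>x'\<in>X. agree n x x' \<longrightarrow> g x' = g x"
  shows "\<exists>n. \<forall>x\<in>X. \<forall>x'\<in>X. agree n x x' \<longrightarrow> g x' = g x"
proof -
  obtain n where n: "\<And>x x'. x \<in> X \<Longrightarrow> x' \<in> X \<Longrightarrow> agree (n x) x x' \<Longrightarrow> g x' = g x"
    using loc by metis
  let ?C = "\<lambda>x. {x' \<in> X. agree (n x) x x'}"
  have "openin (shift_topology X) (?C x)" for x
    unfolding openin_shift_topology by (auto intro: agree_on_trans)
  moreover have "topspace (shift_topology X) \<subseteq> \<Union>(?C ` X)"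
    by auto
  ultimately obtain \<F> where F: "finite \<F>" "\<F> \<subseteq> ?C ` X" "X \<subseteq> \<Union>\<F>"
    using compact_shift_topology[OF assms(1)] unfolding compact_space_alt
    by (metis (no_types, lifting) imageE topspace_shift_topology)
  then obtain D where D: "finite D" "D \<subseteq> X" "\<F> = ?C ` D"
    by (meson finite_subset_image)
  define N where "N = Max (n ` D)"
  have "g x' = g x" if x: "x \<in> X" "x' \<in> X" "agree N x x'" for x x'
  proof -
    obtain c where c: "c \<in> D" "x \<in> ?C c" using F(3) D(3) x(1) by blast
    then have "n c \<le> N" using D(1) by (simp add: N_def)
    then have "agree (n c) c x'" using c(2) x(3) agree_mono agree_on_trans by blast
    then show ?thesis using n[of c x] n[of c x'] c D x by auto
  qed
  then show ?thesis by blast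
qed

lemma continuous_imp_local:
  assumes "continuous_map (shift_topology Y) (shift_topology X) f" "y \<in> Y"
  shows "\<exists>m. \<forall>y'\<in>Y. agree m y y' \<longrightarrow> agree n (f y) (f y')"
proof -
  have im: "f y' \<in> X" if "y' \<in> Y" for y'
    using assms(1) that by (auto simp: continuous_map_def)
  have "openin (shift_topology X) {x' \<in> X. agree n (f y) x'}"
    unfolding openin_shift_topology by (auto intro: agree_on_trans)
  then have "openin (shift_topology Y) {y' \<in> Y. f y' \<in> {x' \<in> X. agree n (f y) x'}}"
    using openin_continuous_map_preimage[OF assms(1)] topspace_shift_topology[of Y] by metis
  then show ?thesis
    unfolding openin_shift_topology using assms(2) im by fastforce
qed

text \<open>The Curtis-Hedlund-Lyndon theorem: the coordinate at 0 of the image is uniformly locally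
  constant, and commutation with translates moves the rule to every coordinate.\<close>

lemma sliding_block_code_radius:
  assumes "shift_space A Y" "sliding_block_code Y X f"
  shows "\<exists>r. \<forall>y\<in>Y. \<forall>y'\<in>Y. \<forall>i. agree_on {i - int r..i + int r} y y' \<longrightarrow> f y i = f y' i"
proof -
  have inv: "shift ` Y = Y" using assms(1) by (simp add: shift_space_def)
  have cont: "continuous_map (shift_topology Y) (shift_topology X) f"
    and com: "\<And>y. y \<in> Y \<Longrightarrow> f (shift y) = shift (f y)"
    using assms(2) by (auto simp: sliding_block_code_def)
  have "\<exists>n. \<forall>y'\<in>Y. agree n y y' \<longrightarrow> f y' 0 = f y 0" if "y \<in> Y" for y
  proof -
    obtain m where m: "\<And>y'. y' \<in> Y \<Longrightarrow> agree m y y' \<Longrightarrow> agree 0 (f y) (f y')"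
      using continuous_imp_local[OF cont \<open>y \<in> Y\<close>, of 0] by blast
    have "f y' 0 = f y 0" if "y' \<in> Y" "agree m y y'" for y'
      using m[OF that] by (simp add: agree_on_def)
    then show ?thesis by blast
  qed
  then obtain r where r: "\<And>y y'. y \<in> Y \<Longrightarrow> y' \<in> Y \<Longrightarrow> agree r y y' \<Longrightarrow> f y' 0 = f y 0"
    using locally_constant_uniform[OF assms(1), of "\<lambda>y. f y 0"] by blast
  have "f y i = f y' i" if "y \<in> Y" "y' \<in> Y" "agree_on {i - int r..i + int r} y y'" for y y' i
  proof -
    have "f (translate i y') 0 = f (translate i y) 0"
      using r translate_in[OF inv] that by (metis agree_translate_iff)
    then show ?thesis
      using translate_commute[of Y f, OF inv com] that by (simp add: translate_def)
  qed
  then show ?thesis by blast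
qed

definition splice :: "int \<Rightarrow> (int \<Rightarrow> 'a) \<Rightarrow> (int \<Rightarrow> 'a) \<Rightarrow> int \<Rightarrow> 'a" where
  "splice c x y = (\<lambda>i. if i \<le> c then x i else y i)"

lemma agree_on_spliceR: "agree_on {c - k..c} x y \<Longrightarrow> S \<subseteq> {c - k..} \<Longrightarrow> agree_on S (splice c x y) y"
  by (auto simp: agree_on_def splice_def)

text \<open>\<open>m\<close> bounds the lengths of the forbidden words. A word that starts left of
  \<open>c - m\<close> ends before the seam and is read in \<open>x\<close>; a word that starts
  later is read where the splice already equals \<open>y\<close>.\<close>

lemma sft_splice:
  assumes "sft A X"
  shows "\<exists>m::nat. \<forall>x\<in>X. \<forall>y\<in>X. \<forall>c. agree_on {c - int m..c} x y \<longrightarrow> splice c x y \<in> X"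
proof -
  obtain F where F: "finite F" "X = {x. range x \<subseteq> A \<and> (\<forall>w\<in>F. \<not> occurs w x)}"
    using assms by (auto simp: sft_def)
  obtain m where m: "\<And>w. w \<in> F \<Longrightarrow> length w \<le> m"
    using F(1) by (metis finite_nat_set_iff_bounded_le finite_imageI image_eqI)
  have "splice c x y \<in> X" if "x \<in> X" "y \<in> X" and ag: "agree_on {c - int m..c} x y" for x y c
  proof -
    have "\<not> occurs w (splice c x y)" if w: "w \<in> F" for w
    proof
      assume "occurs w (splice c x y)"
      then obtain i where i: "\<And>k. k < length w \<Longrightarrow> splice c x y (i + int k) = w ! k"
        by (auto simp: occurs_def)
      show False
      proof (cases "i < c - int m")
        case True
        have "x (i + int k) = w ! k" if "k < length w" for k
          using i[OF that] True m[OF w] that by (simp add: splice_def)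
        then have "occurs w x" by (auto simp: occurs_def)
        then show False using \<open>x \<in> X\<close> F(2) w by auto
      next
        case False
        have "agree_on {c - int m..} (splice c x y) y"
          using ag by (rule agree_on_spliceR) simp
        then have "y (i + int k) = w ! k" if "k < length w" for k
          using i[OF that] False by (auto simp: agree_on_def)
        then have "occurs w y" by (auto simp: occurs_def)
        then show False using \<open>y \<in> X\<close> F(2) w by auto
      qed
    qed
    moreover have "range (splice c x y) \<subseteq> A"
      using \<open>x \<in> X\<close> \<open>y \<in> X\<close> F(2) by (auto simp: splice_def)
    ultimately show ?thesis using F(2) by auto
  qed
  then show ?thesis by blast
qed

section \<open>Connecting points of irreducible shifts\<close>

definition occurs_at :: "'a list \<Rightarrow> int \<Rightarrow> (int \<Rightarrow> 'a) \<Rightarrow> bool" where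
  "occurs_at w i x \<longleftrightarrow> (\<forall>k<length w. x (i + int k) = w ! k)"

definition subword :: "(int \<Rightarrow> 'a) \<Rightarrow> int \<Rightarrow> nat \<Rightarrow> 'a list" where
  "subword x i n = map (\<lambda>k. x (i + int k)) [0..<n]"

lemma length_subword [simp]: "length (subword x i n) = n"
  by (simp add: subword_def)

lemma occurs_at_append:
  "occurs_at (u @ v) i x \<longleftrightarrow> occurs_at u i x \<and> occurs_at v (i + int (length u)) x"
proof -
  have "(\<forall>k<length u + length v. x (i + int k) = (u @ v) ! k) \<longleftrightarrow>
    (\<forall>k<length u. x (i + int k) = u ! k) \<and> (\<forall>k<length v. x (i + int (length u) + int k) = v ! k)"
    (is "?L \<longleftrightarrow> ?R")
  proof
    assume L: ?L
    show ?R
    proof (intro conjI allI impI)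
      fix k assume "k < length u"
      then show "x (i + int k) = u ! k" using L[rule_format, of k] by (simp add: nth_append)
    next
      fix k assume "k < length v"
      then show "x (i + int (length u) + int k) = v ! k"
        using L[rule_format, of "length u + k"] by (simp add: nth_append add.assoc)
    qed
  next
    assume R: ?R
    show ?L
    proof (intro allI impI)
      fix k assume "k < length u + length v"
      then show "x (i + int k) = (u @ v) ! k"
        using R[THEN conjunct1, rule_format, of k] R[THEN conjunct2, rule_format, of "k - length u"]
        by (auto simp: nth_append)
    qed
  qed
  then show ?thesis by (simp add: occurs_at_def)
qed

lemma occurs_at_subword:
  "occurs_at (subword x i n) j y \<longleftrightarrow> agree_on {i..<i + int n} x (translate (j - i) y)"
proof -
  have "(\<forall>k<n. y (j + int k) = x (i + int k)) \<longleftrightarrow> (\<forall>l\<in>{i..<i + int n}. x l = y (l + (j - i)))"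
    (is "?L \<longleftrightarrow> ?R")
  proof
    assume L: ?L
    show ?R
    proof
      fix l assume "l \<in> {i..<i + int n}"
      then obtain k where "l = i + int k" "k < n" by (auto simp: zle_iff_zadd)
      then show "x l = y (l + (j - i))" using L by (simp add: algebra_simps)
    qed
  next
    assume R: ?R
    show ?L
    proof (intro allI impI)
      fix k assume "k < n"
      then show "y (j + int k) = x (i + int k)"
        using R[rule_format, of "i + int k"] by (simp add: algebra_simps)
    qed
  qed
  then show ?thesis
    by (simp add: occurs_at_def agree_on_def translate_def subword_def)
qed

lemma in_language_iff: "w \<in> language X \<longleftrightarrow> (\<exists>x\<in>X. \<exists>i. occurs_at w i x)"
  by (auto simp: language_def occurs_def occurs_at_def)

lemma subword_in_language: "x \<in> X \<Longrightarrow> subword x i n \<in> language X"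
  unfolding in_language_iff by (intro bexI[of _ x] exI[of _ i]) (auto simp: occurs_at_subword)

lemma occurs_at_translate: "occurs_at w i (translate n x) \<longleftrightarrow> occurs_at w (i + n) x"
  by (simp add: occurs_at_def translate_def add_ac)

lemma sft_shift_space: "sft A X \<Longrightarrow> shift_space A X"
  by (simp add: sft_def)

lemma irreducible_sft_shift_space: "irreducible_sft A X \<Longrightarrow> shift_space A X"
  by (simp add: irreducible_sft_def sft_def)

lemma shift_space_shift_image: "shift_space A X \<Longrightarrow> shift ` X = X"
  by (simp add: shift_space_def)

text \<open>Irreducibility is applied twice, to enclose the central word of \<open>x\<close> between
  two copies of the central word of \<open>c\<close>. The inequalities say that the two copies lie
  strictly to the left and to the right of the central window of radius \<open>m\<close>.\<close>

lemma irreducible_two_sided: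
  assumes X: "irreducible_sft A X" and "x \<in> X" "c \<in> X"
  shows "\<exists>t\<in>X. \<exists>p q. agree m x t \<and> agree n c (translate p t) \<and> agree n c (translate q t)
    \<and> p + int m + int n < 0 \<and> int m + int n < q"
proof -
  let ?u = "subword x (- int m) (2 * m + 1)" and ?w = "subword c (- int n) (2 * n + 1)"
  have irr: "\<And>u v. u \<in> language X \<Longrightarrow> v \<in> language X \<Longrightarrow> \<exists>w. w \<noteq> [] \<and> u @ w @ v \<in> language X"
    using X by (auto simp: irreducible_sft_def)
  have inv: "shift ` X = X" using X irreducible_sft_shift_space shift_space_shift_image by blast
  obtain a where a: "a \<noteq> []" "?w @ a @ ?u \<in> language X"
    using irr subword_in_language assms(2,3) by metis
  obtain b where b: "b \<noteq> []" "(?w @ a @ ?u) @ b @ ?w \<in> language X"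
    using irr[OF a(2) subword_in_language[OF assms(3)]] by metis
  then obtain s i where s: "s \<in> X" "occurs_at ((?w @ a @ ?u) @ b @ ?w) i s"
    unfolding in_language_iff by blast
  define j where "j = i + int (2 * n + 1) + int (length a)"
  define e where "e = j + int (2 * m + 1) + int (length b)"
  have occ: "occurs_at ?w i s" "occurs_at ?u j s" "occurs_at ?w e s"
    using s(2) by (simp_all add: occurs_at_append j_def e_def add_ac)
  define t where "t = translate (j + int m) s"
  \<comment> \<open>A word of length \<open>2 * k + 1\<close> read from position \<open>- k\<close>
    covers exactly the window of radius \<open>k\<close>.\<close>
  have set: "{- int k..<- int k + int (2 * k + 1)} = {- int k..int k}" for k by auto
  have "t \<in> X" using s(1) inv by (simp add: t_def translate_in)
  moreover have "agree m x t"
    using occ(2) by (simp only: occurs_at_subword set t_def) (simp add: algebra_simps)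
  moreover have "agree n c (translate (i + int n - (j + int m)) t)"
    using occ(1) by (simp only: occurs_at_subword set t_def translate_translate) (simp add: algebra_simps)
  moreover have "agree n c (translate (e + int n - (j + int m)) t)"
    using occ(3) by (simp only: occurs_at_subword set t_def translate_translate) (simp add: algebra_simps)
  moreover have "i + int n - (j + int m) + int m + int n < 0" by (simp add: j_def)
  moreover have "int m + int n < e + int n - (j + int m)" using b(1) by (simp add: e_def)
  ultimately show ?thesis by blast
qed

definition left_asymptotic :: "(int \<Rightarrow> 'a) \<Rightarrow> (int \<Rightarrow> 'a) \<Rightarrow> bool" where
  "left_asymptotic x y \<longleftrightarrow> (\<exists>a. agree_on {..a} x y)"

definition right_asymptotic :: "(int \<Rightarrow> 'a) \<Rightarrow> (int \<Rightarrow> 'a) \<Rightarrow> bool" where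
  "right_asymptotic x y \<longleftrightarrow> (\<exists>a. agree_on {a..} x y)"

text \<open>A point through the connecting word is spliced with the left tail of \<open>x\<close> at
  coordinate 0, and then with the right tail of a translate of \<open>y\<close>. The words at the
  two ends have length \<open>m + 1\<close>, the overlap that \<open>sft_splice\<close> asks
  for.\<close>

lemma irreducible_connecting_point:
  assumes X: "irreducible_sft A X" and "x \<in> X" "y \<in> X"
  shows "\<exists>t\<in>X. \<exists>n. left_asymptotic x t \<and> right_asymptotic t (translate n y)"
proof -
  have inv: "shift ` X = X" using X irreducible_sft_shift_space shift_space_shift_image by blast
  have "sft A X" using X by (simp add: irreducible_sft_def)
  then obtain m where m: "\<And>x y c. x \<in> X \<Longrightarrow> y \<in> X \<Longrightarrow> agree_on {c - int m..c} x y \<Longrightarrow> splice c x y \<in> X"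
    using sft_splice by blast
  let ?u = "subword x (- int m) (m + 1)" and ?v = "subword y 0 (m + 1)"
  obtain w where "?u @ w @ ?v \<in> language X"
    using X subword_in_language assms(2,3) unfolding irreducible_sft_def by metis
  then obtain s i where s: "s \<in> X" "occurs_at (?u @ w @ ?v) i s"
    unfolding in_language_iff by blast
  \<comment> \<open>In the coordinates of \<open>s'\<close> the word of \<open>x\<close> ends at 0
    and \<open>w\<close> fills \<open>1..length w\<close>, so the word of \<open>y\<close> starts at
    \<open>q\<close>.\<close>
  define q where "q = int (1 + length w)"
  define s' where "s' = translate (i + int m) s"
  have s'X: "s' \<in> X" using s(1) inv by (simp add: s'_def translate_in)
  have occ: "occurs_at ?u (- int m) s'" "occurs_at ?v q s'"
    using s(2) by (simp_all add: occurs_at_append s'_def q_def occurs_at_translate add_ac)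
  have u: "agree_on {- int m..0} x s'"
    using occ(1) by (auto simp: occurs_at_subword agree_on_def)
  have v: "agree_on {0..int m} y (translate q s')"
    using occ(2) by (auto simp: occurs_at_subword agree_on_def)
  define s1 where "s1 = splice 0 x s'"
  have s1X: "s1 \<in> X" using m[of x s' 0] u assms(2) s'X by (simp add: s1_def)
  have s1: "agree_on {- int m..} s1 s'"
    unfolding s1_def by (rule agree_on_spliceR[of 0 "int m"]) (use u in auto)
  define y' where "y' = translate (- q) y"
  have y'X: "y' \<in> X" using assms(3) inv by (simp add: y'_def translate_in)
  have s1y: "agree_on {q..q + int m} s1 y'"
    unfolding agree_on_def
  proof
    fix i assume i: "i \<in> {q..q + int m}"
    then have "s1 i = s' i" using s1 by (auto simp: agree_on_def q_def)
    moreover have "y (i - q) = translate q s' (i - q)" using v i by (simp add: agree_on_def)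
    ultimately show "s1 i = y' i" by (simp add: y'_def translate_def)
  qed
  define t where "t = splice (q + int m) s1 y'"
  have "t \<in> X" using m[of s1 y' "q + int m"] s1y s1X y'X by (simp add: t_def)
  moreover have "agree_on {..0} x t"
    by (auto simp: agree_on_def t_def s1_def splice_def q_def)
  moreover have "agree_on {q..} t y'"
    unfolding t_def by (rule agree_on_spliceR[of _ "int m"]) (use s1y in auto)
  ultimately show ?thesis
    unfolding left_asymptotic_def right_asymptotic_def y'_def by blast
qed

section \<open>Separation of fibres\<close>

text \<open>Irreducibility of the base spreads separation from one cylinder to all fibres; finite
  type of the cover permits splicing inside a fibre.\<close>

locale constant_to_one =
  fixes A :: "'a set" and X :: "(int \<Rightarrow> 'a) set" and B :: "'b set" and Y :: "(int \<Rightarrow> 'b) set"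
    and \<pi> :: "(int \<Rightarrow> 'b) \<Rightarrow> int \<Rightarrow> 'a" and d :: nat
  assumes X: "irreducible_sft A X" and Y: "sft B Y"
    and factor: "factor_map Y X \<pi>" and degree: "has_degree Y X \<pi> d"
begin

lemma code: "sliding_block_code Y X \<pi>"
  using factor by (simp add: factor_map_def)

lemma maps_to: "y \<in> Y \<Longrightarrow> \<pi> y \<in> X"
  using code by (auto simp: sliding_block_code_def)

lemma continuous: "continuous_map (shift_topology Y) (shift_topology X) \<pi>"
  using code by (simp add: sliding_block_code_def)

lemma shift_space_X: "shift_space A X" and shift_space_Y: "shift_space B Y"
  using X Y by (simp_all add: irreducible_sft_shift_space sft_shift_space)

lemma translate_X: "x \<in> X \<Longrightarrow> translate n x \<in> X"
  and translate_Y: "y \<in> Y \<Longrightarrow> translate n y \<in> Y"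
  using shift_space_X shift_space_Y by (simp_all add: translate_in shift_space_shift_image)

lemma pi_translate: "y \<in> Y \<Longrightarrow> \<pi> (translate n y) = translate n (\<pi> y)"
  using translate_commute[of Y \<pi>, OF shift_space_shift_image[OF shift_space_Y]] code
  by (simp add: sliding_block_code_def)

abbreviation fibre :: "(int \<Rightarrow> 'a) \<Rightarrow> (int \<Rightarrow> 'b) set" where
  "fibre x \<equiv> {y \<in> Y. \<pi> y = x}"

definition fibre_windows :: "nat \<Rightarrow> (int \<Rightarrow> 'a) \<Rightarrow> (int \<Rightarrow> 'b) set" where
  "fibre_windows K x = window K ` fibre x"

lemma card_fibre: "x \<in> X \<Longrightarrow> card (fibre x) = d"
  using degree by (simp add: has_degree_def)

lemma finite_fibre: "x \<in> X \<Longrightarrow> finite (fibre x)"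
  using degree card_fibre[of x] by (intro card_ge_0_finite) (simp add: has_degree_def)

lemma finite_fibre_windows: "x \<in> X \<Longrightarrow> finite (fibre_windows K x)"
  unfolding fibre_windows_def by (intro finite_imageI finite_fibre)

lemma card_fibre_windows_le: "x \<in> X \<Longrightarrow> card (fibre_windows K x) \<le> d"
  unfolding fibre_windows_def using card_image_le[OF finite_fibre, of x "window K"] card_fibre[of x] by simp

lemma card_fibre_windows_eq_iff:
  assumes "x \<in> X"
  shows "card (fibre_windows K x) = d \<longleftrightarrow>
    (\<forall>y\<in>Y. \<forall>z\<in>Y. \<pi> y = x \<and> \<pi> z = x \<and> agree K y z \<longrightarrow> y = z)"
proof -
  have "card (fibre_windows K x) = d \<longleftrightarrow> inj_on (window K) (fibre x)"
    unfolding fibre_windows_def inj_on_iff_eq_card[OF finite_fibre[OF assms]] card_fibre[OF assms] ..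
  then show ?thesis by (auto simp: inj_on_def agree_iff_window)
qed

text \<open>\<open>\<pi>\<close> is a closed map, as its source is compact and its target Hausdorff.
  The points whose window occurs over \<open>x\<close> form an open neighbourhood of the fibre of
  \<open>x\<close>, hence contain all nearby fibres. Only an inclusion results: a window over
  \<open>x\<close> may have no counterpart over nearby points.\<close>

lemma fibre_windows_semicontinuous:
  assumes "x \<in> X"
  shows "\<exists>n. \<forall>x'\<in>X. agree n x x' \<longrightarrow> fibre_windows K x' \<subseteq> fibre_windows K x"
proof -
  have cl: "closed_map (shift_topology Y) (shift_topology X) \<pi>"
    by (rule continuous_imp_closed_map[OF continuous compact_shift_topology[OF shift_space_Y] Hausdorff_shift_topology])
  let ?U = "{y \<in> Y. window K y \<in> fibre_windows K x}"
  have U: "openin (shift_topology Y) ?U"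
    unfolding openin_shift_topology
    by (intro conjI ballI exI[of _ K] impI) (auto simp: agree_iff_window)
  obtain V where V: "openin (shift_topology X) V" "x \<in> V" "{y \<in> Y. \<pi> y \<in> V} \<subseteq> ?U"
    using cl[unfolded closed_map_fibre_neighbourhood, THEN conjunct2, rule_format, of ?U x] U assms
    by (auto simp: fibre_windows_def)
  obtain n where n: "\<And>x'. x' \<in> X \<Longrightarrow> agree n x x' \<Longrightarrow> x' \<in> V"
    using V(1,2) unfolding openin_shift_topology by metis
  show ?thesis
    using n V(3) by (intro exI[of _ n]) (auto simp: fibre_windows_def)
qed

text \<open>A fibre has finitely many pairs of distinct points, so one radius tells all of them
  apart. At this stage the radius depends on \<open>x\<close>.\<close>

lemma fibre_windows_separate:
  assumes "x \<in> X"
  shows "\<exists>K. card (fibre_windows K x) = d"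
proof -
  have "\<exists>K. \<not> agree K y z" if "y \<noteq> z" for y z :: "int \<Rightarrow> 'b"
  proof -
    obtain i where "y i \<noteq> z i" using \<open>y \<noteq> z\<close> by blast
    then have "\<not> agree (nat \<bar>i\<bar>) y z" by (auto simp: agree_on_def intro!: bexI[of _ i])
    then show ?thesis by blast
  qed
  then obtain k where k: "\<And>y z :: int \<Rightarrow> 'b. y \<noteq> z \<Longrightarrow> \<not> agree (k y z) y z" by metis
  define K where "K = Max ((\<lambda>(y, z). k y z) ` (fibre x \<times> fibre x))"
  have "k y z \<le> K" if "y \<in> fibre x" "z \<in> fibre x" for y z
    unfolding K_def using finite_fibre[OF assms] that by (intro Max_ge) auto
  then have "card (fibre_windows K x) = d"
    unfolding card_fibre_windows_eq_iff[OF assms] using k agree_mono by blast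
  then show ?thesis by blast
qed

text \<open>The points separated at radius \<open>N\<close> form a closed set: by semicontinuity a
  count below \<open>d\<close> stays below \<open>d\<close> nearby. These sets cover the compact
  Hausdorff space \<open>X\<close>, so by the Baire theorem one of them has an interior
  point.\<close>

lemma exists_separating_cylinder:
  "\<exists>c\<in>X. \<exists>n N. \<forall>x\<in>X. agree n c x \<longrightarrow> card (fibre_windows N x) = d"
proof (rule ccontr)
  assume neg: "\<not> ?thesis"
  let ?T = "shift_topology X" and ?U = "\<lambda>N. {x \<in> X. card (fibre_windows N x) = d}"
  have cl: "closedin ?T (?U N)" for N
  proof -
    have "\<exists>n. \<forall>x'\<in>X. agree n x x' \<longrightarrow> card (fibre_windows N x') \<noteq> d"
      if "x \<in> X" "card (fibre_windows N x) \<noteq> d" for x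
    proof -
      have lt: "card (fibre_windows N x) < d" using that card_fibre_windows_le[of x N] by simp
      obtain n where "\<forall>x'\<in>X. agree n x x' \<longrightarrow> fibre_windows N x' \<subseteq> fibre_windows N x"
        using fibre_windows_semicontinuous \<open>x \<in> X\<close> by blast
      then have "\<forall>x'\<in>X. agree n x x' \<longrightarrow> card (fibre_windows N x') \<le> card (fibre_windows N x)"
        using card_mono[OF finite_fibre_windows] \<open>x \<in> X\<close> by blast
      then show ?thesis using lt by (metis leD)
    qed
    then have "openin ?T (X - ?U N)" unfolding openin_shift_topology by auto
    then show ?thesis by (simp add: closedin_def)
  qed
  have int: "?T interior_of ?U N = {}" for N
  proof (rule ccontr)
    assume "?T interior_of ?U N \<noteq> {}"
    then obtain c where c: "c \<in> ?T interior_of ?U N" by blast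
    have "openin ?T (?T interior_of ?U N)" by simp
    then obtain n where "\<forall>x\<in>X. agree n c x \<longrightarrow> x \<in> ?T interior_of ?U N"
      using c unfolding openin_shift_topology by blast
    moreover have "?T interior_of ?U N \<subseteq> ?U N" by (rule interior_of_subset)
    ultimately show False using neg c by blast
  qed
  have "locally_compact_space ?T \<and> regular_space ?T"
    using compact_shift_topology[OF shift_space_X] Hausdorff_shift_topology[of X]
    by (meson compact_imp_locally_compact_space compact_Hausdorff_imp_regular_space)
  then have "?T interior_of \<Union>(range ?U) = {}"
    using cl int by (intro Baire_category_alt) auto
  moreover have "\<Union>(range ?U) = topspace ?T"
    using fibre_windows_separate by auto
  ultimately have "X = {}" by (metis interior_of_topspace topspace_shift_topology)
  then show False using shift_space_X by (simp add: shift_space_def)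
qed

text \<open>Two points of a fibre that agree on a long central window can be spliced there. Over a point
  that visits a separating cylinder on both sides of the window, the spliced point coincides with
  both. Such points are dense, and semicontinuity carries the separation over to all fibres.\<close>

lemma uniform_separation:
  "\<exists>K. \<forall>x\<in>X. card (fibre_windows K x) = d"
proof -
  obtain c n N where c: "c \<in> X" and sep: "\<And>x. x \<in> X \<Longrightarrow> agree n c x \<Longrightarrow> card (fibre_windows N x) = d"
    using exists_separating_cylinder by blast
  obtain m where m: "\<And>x y c. x \<in> Y \<Longrightarrow> y \<in> Y \<Longrightarrow> agree_on {c - int m..c} x y \<Longrightarrow> splice c x y \<in> Y"
    using sft_splice[OF Y] by blast
  obtain r where r: "\<And>y y' i. y \<in> Y \<Longrightarrow> y' \<in> Y \<Longrightarrow> agree_on {i - int r..i + int r} y y' \<Longrightarrow> \<pi> y i = \<pi> y' i"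
    using sliding_block_code_radius[OF shift_space_Y code] by metis
  \<comment> \<open>\<open>m\<close> is the overlap needed to splice in \<open>Y\<close>, and
    \<open>r\<close> is the radius of \<open>\<pi>\<close>; neither depends on
    \<open>x\<close>.\<close>
  define K where "K = max m r"
  have "card (fibre_windows K x) = d" if x: "x \<in> X" for x
  proof -
    obtain n0 where n0: "\<And>x'. x' \<in> X \<Longrightarrow> agree n0 x x' \<Longrightarrow> fibre_windows K x' \<subseteq> fibre_windows K x"
      using fibre_windows_semicontinuous[OF x] by blast
    \<comment> \<open>\<open>n0\<close> puts the windows over \<open>t\<close> among those over
      \<open>x\<close>. \<open>N\<close> keeps the windows of radius \<open>N\<close> at the visits
      \<open>p\<close> and \<open>q\<close> on one side of the origin, where the splice copies one
      of the two points.\<close>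
    obtain t p q where t: "t \<in> X" "agree (max n0 N) x t"
      "agree n c (translate p t)" "agree n c (translate q t)"
      "p + int (max n0 N) + int n < 0" "int (max n0 N) + int n < q"
      using irreducible_two_sided[OF X x c] by metis
    \<comment> \<open>Moving the visit \<open>e\<close> to the origin puts the base point in the
      separating cylinder, where agreement to radius \<open>N\<close> forces equality.\<close>
    have at: "y = z" if "y \<in> Y" "z \<in> Y" "\<pi> y = t" "\<pi> z = t"
      "agree_on {e - int N..e + int N} y z" "agree n c (translate e t)" for y z e
    proof -
      have "card (fibre_windows N (translate e t)) = d" 
        using sep translate_X t(1) that(6) by blast
      moreover have "agree N (translate e y) (translate e z)"
        using that(5) by (simp add: agree_translate_iff)
      ultimately have "translate e y = translate e z"
        using that translate_X[OF t(1)] translate_Y card_fibre_windows_eq_iff pi_translate by metis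
      then have "translate (- e) (translate e y) = translate (- e) (translate e z)" by simp
      then show ?thesis by simp
    qed
    have "y = z" if yz: "y \<in> Y" "z \<in> Y" "\<pi> y = t" "\<pi> z = t" "agree K y z" for y z
    proof -
      define s where "s = splice 0 y z"
      have ag: "agree_on {0 - int K..0} y z" using yz(5) by (rule agree_on_mono) auto
      have sy: "agree_on {..int K} s y"
        using yz(5) by (auto simp: s_def splice_def agree_on_def)
      have sz: "agree_on {- int K..} s z"
        unfolding s_def using ag by (rule agree_on_spliceR) simp
      have sY: "s \<in> Y"
        unfolding s_def by (rule m[OF yz(1,2) agree_on_mono[OF ag]]) (simp add: K_def)
      \<comment> \<open>Since \<open>r \<le> K\<close>, the window of radius \<open>r\<close> about
        \<open>i \<le> 0\<close> stays in \<open>{..K}\<close>, and the one about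
        \<open>i > 0\<close> stays in \<open>{- K..}\<close>; on each half-line \<open>s\<close>
        copies a point over \<open>t\<close>.\<close>
      have "\<pi> s i = t i" for i
      proof (cases "i \<le> 0")
        case True
        then have "\<pi> s i = \<pi> y i"
          by (intro r[OF sY yz(1)] agree_on_mono[OF sy]) (auto simp: K_def)
        then show ?thesis using yz(3) by simp
      next
        case False
        then have "\<pi> s i = \<pi> z i"
          by (intro r[OF sY yz(2)] agree_on_mono[OF sz]) (auto simp: K_def)
        then show ?thesis using yz(4) by simp
      qed
      then have st: "\<pi> s = t" by blast
      have "s = y"
        by (rule at[OF sY yz(1) st yz(3) agree_on_mono[OF sy] t(3)]) (use t(5) in auto)
      moreover have "s = z"
        by (rule at[OF sY yz(2) st yz(4) agree_on_mono[OF sz] t(4)]) (use t(6) in auto)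
      ultimately show ?thesis by simp
    qed
    then have "card (fibre_windows K t) = d"
      unfolding card_fibre_windows_eq_iff[OF t(1)] by blast
    \<comment> \<open>The \<open>d\<close> windows over \<open>t\<close> all occur over
      \<open>x\<close>, so \<open>x\<close> has at least, hence exactly, \<open>d\<close> of
      them.\<close>
    moreover have "fibre_windows K t \<subseteq> fibre_windows K x"
      by (rule n0[OF t(1) agree_mono[OF t(2)]]) simp
    ultimately show ?thesis
      using card_mono[OF finite_fibre_windows[OF x]] card_fibre_windows_le[OF x] by (metis le_antisym)
  qed
  then show ?thesis by blast
qed

text \<open>Once all the finite sets of windows have the same size, the inclusion given by
  semicontinuity is an equality, and compactness makes its radius uniform.\<close>

lemma fibre_windows_locally_constant:
  assumes K: "\<And>x. x \<in> X \<Longrightarrow> card (fibre_windows K x) = d"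
  shows "\<exists>L. \<forall>x\<in>X. \<forall>x'\<in>X. agree L x x' \<longrightarrow> fibre_windows K x' = fibre_windows K x"
proof (rule locally_constant_uniform[OF shift_space_X])
  fix x assume x: "x \<in> X"
  obtain n where n: "\<And>x'. x' \<in> X \<Longrightarrow> agree n x x' \<Longrightarrow> fibre_windows K x' \<subseteq> fibre_windows K x"
    using fibre_windows_semicontinuous[OF x] by blast
  have "fibre_windows K x' = fibre_windows K x" if "x' \<in> X" "agree n x x'" for x'
    by (rule card_subset_eq[OF finite_fibre_windows[OF x] n[OF that]]) (simp add: K x that)
  then show "\<exists>n. \<forall>x'\<in>X. agree n x x' \<longrightarrow> fibre_windows K x' = fibre_windows K x" by blast
qed

end

section \<open>Lifting asymptotic points\<close>

lemma translate_cancel: "translate n x = translate n y \<Longrightarrow> x = y"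
  by (metis add.left_inverse translate_0 translate_translate)

lemma left_asymptotic_sym: "left_asymptotic x y \<Longrightarrow> left_asymptotic y x"
  unfolding left_asymptotic_def using agree_on_sym by blast

lemma right_asymptotic_sym: "right_asymptotic x y \<Longrightarrow> right_asymptotic y x"
  unfolding right_asymptotic_def using agree_on_sym by blast

lemma left_asymptotic_trans:
  assumes "left_asymptotic x y" "left_asymptotic y z"
  shows "left_asymptotic x z"
proof -
  obtain a b where "agree_on {..a} x y" "agree_on {..b} y z"
    using assms unfolding left_asymptotic_def by blast
  then have "agree_on {..min a b} x z" by (simp add: agree_on_def)
  then show ?thesis unfolding left_asymptotic_def by blast
qed

lemma right_asymptotic_trans:
  assumes "right_asymptotic x y" "right_asymptotic y z"
  shows "right_asymptotic x z"
proof -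
  obtain a b where "agree_on {a..} x y" "agree_on {b..} y z"
    using assms unfolding right_asymptotic_def by blast
  then have "agree_on {max a b..} x z" by (simp add: agree_on_def)
  then show ?thesis unfolding right_asymptotic_def by blast
qed

lemma sliding_block_code_left_asymptotic:
  assumes "shift_space B Y" "sliding_block_code Y Z f" "y \<in> Y" "y' \<in> Y" "left_asymptotic y y'"
  shows "left_asymptotic (f y) (f y')"
proof -
  obtain r where r: "\<And>i. agree_on {i - int r..i + int r} y y' \<Longrightarrow> f y i = f y' i"
    using sliding_block_code_radius[OF assms(1,2)] assms(3,4) by blast
  obtain a where a: "agree_on {..a} y y'" using assms(5) unfolding left_asymptotic_def by blast
  have "agree_on {..a - int r} (f y) (f y')"
    unfolding agree_on_def by (intro ballI r agree_on_mono[OF a]) auto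
  then show ?thesis unfolding left_asymptotic_def by blast
qed

lemma sliding_block_code_right_asymptotic:
  assumes "shift_space B Y" "sliding_block_code Y Z f" "y \<in> Y" "y' \<in> Y" "right_asymptotic y y'"
  shows "right_asymptotic (f y) (f y')"
proof -
  obtain r where r: "\<And>i. agree_on {i - int r..i + int r} y y' \<Longrightarrow> f y i = f y' i"
    using sliding_block_code_radius[OF assms(1,2)] assms(3,4) by blast
  obtain a where a: "agree_on {a..} y y'" using assms(5) unfolding right_asymptotic_def by blast
  have "agree_on {a + int r..} (f y) (f y')"
    unfolding agree_on_def by (intro ballI r agree_on_mono[OF a]) auto
  then show ?thesis unfolding right_asymptotic_def by blast
qed

text \<open>\<open>lifts_path Y \<pi> t n y y'\<close>: some lift of \<open>t\<close> leads from \<open>y\<close> in the far left to a translate of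
  \<open>y'\<close> in the far right. The point \<open>t\<close> plays the part of a path between the base points, and the
  relation that of its monodromy.\<close>

definition lifts_path ::
    "(int \<Rightarrow> 'b) set \<Rightarrow> ((int \<Rightarrow> 'b) \<Rightarrow> int \<Rightarrow> 'a) \<Rightarrow> (int \<Rightarrow> 'a) \<Rightarrow> int \<Rightarrow>
      (int \<Rightarrow> 'b) \<Rightarrow> (int \<Rightarrow> 'b) \<Rightarrow> bool" where
  "lifts_path Y \<pi> t n y y' \<longleftrightarrow>
     (\<exists>s\<in>Y. \<pi> s = t \<and> left_asymptotic y s \<and> right_asymptotic s (translate n y'))"

text \<open>Local rules respect tails, so a code over the base carries a lift of \<open>t\<close> to
  a lift of \<open>t\<close>. This is the naturality that ties together the base points of different
  covers.\<close>

lemma lifts_path_map: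
  assumes Y: "shift_space B Y" and f: "sliding_block_code Y Z f"
    and over: "\<And>y. y \<in> Y \<Longrightarrow> \<rho> (f y) = \<pi> y"
    and y: "y \<in> Y" "y' \<in> Y" "lifts_path Y \<pi> t n y y'"
  shows "lifts_path Z \<rho> t n (f y) (f y')"
proof -
  obtain s where s: "s \<in> Y" "\<pi> s = t" "left_asymptotic y s" "right_asymptotic s (translate n y')"
    using y(3) unfolding lifts_path_def by blast
  have inv: "shift ` Y = Y" using Y by (rule shift_space_shift_image)
  have "translate n (f y') = f (translate n y')"
    using translate_commute[of Y f, OF inv _ y(2)] f by (simp add: sliding_block_code_def)
  then have "right_asymptotic (f s) (translate n (f y'))"
    using sliding_block_code_right_asymptotic[OF Y f s(1) translate_in[OF inv y(2)] s(4)] by simp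
  moreover have "left_asymptotic (f y) (f s)"
    by (rule sliding_block_code_left_asymptotic[OF Y f y(1) s(1,3)])
  moreover have "f s \<in> Z" using f s(1) by (auto simp: sliding_block_code_def)
  ultimately show ?thesis
    unfolding lifts_path_def using over s by blast
qed

context constant_to_one
begin

text \<open>\<open>K\<close> is the radius of separation, whereas \<open>L\<close> controls the
  fibre windows of radius \<open>K + 1\<close>. The extra coordinate on each side is the gain by
  which an agreement later propagates.\<close>

lemma uniform_separation_lift:
  "\<exists>K L::nat. (\<forall>y\<in>Y. \<forall>z\<in>Y. \<forall>i. \<pi> y = \<pi> z \<and> agree_on {i - int K..i + int K} y z \<longrightarrow> y = z) \<and>
    (\<forall>y\<in>Y. \<forall>x\<in>X. \<forall>i. agree_on {i - int L..i + int L} (\<pi> y) x \<longrightarrow>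
      (\<exists>z\<in>Y. \<pi> z = x \<and> agree_on {i - int K - 1..i + int K + 1} y z))"
proof -
  obtain K where K: "\<And>x. x \<in> X \<Longrightarrow> card (fibre_windows K x) = d"
    using uniform_separation by blast
  have sep: "y = z" if "y \<in> Y" "z \<in> Y" "\<pi> y = \<pi> z" "agree K y z" for y z
    using K card_fibre_windows_eq_iff maps_to that by blast
  \<comment> \<open>Separation passes to the larger radius, so the windows of radius
    \<open>Suc K\<close> also number \<open>d\<close> and are locally constant.\<close>
  have "card (fibre_windows (Suc K) x) = d" if "x \<in> X" for x
    unfolding card_fibre_windows_eq_iff[OF that]
    using sep agree_mono[of "Suc K" _ _ K] by (metis le_SucI order_refl)
  then obtain L where L: "\<And>x x'. x \<in> X \<Longrightarrow> x' \<in> X \<Longrightarrow> agree L x x' \<Longrightarrow>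
      fibre_windows (Suc K) x' = fibre_windows (Suc K) x"
    using fibre_windows_locally_constant[of "Suc K"] by blast
  have "y = z" if "y \<in> Y" "z \<in> Y" "\<pi> y = \<pi> z" "agree_on {i - int K..i + int K} y z" for y z i
  proof -
    have "translate i y = translate i z"
      by (rule sep) (use that in \<open>simp_all add: translate_Y pi_translate agree_translate_iff\<close>)
    then show ?thesis by (rule translate_cancel)
  qed
  moreover have "\<exists>z\<in>Y. \<pi> z = x \<and> agree_on {i - int K - 1..i + int K + 1} y z"
    if "y \<in> Y" "x \<in> X" "agree_on {i - int L..i + int L} (\<pi> y) x" for y x i
  proof -
    have "agree L (\<pi> (translate i y)) (translate i x)"
      using that by (simp add: pi_translate agree_translate_iff)
    then have "fibre_windows (Suc K) (translate i x) = fibre_windows (Suc K) (\<pi> (translate i y))"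
      using L that by (simp add: maps_to translate_X translate_Y)
    moreover have "window (Suc K) (translate i y) \<in> fibre_windows (Suc K) (\<pi> (translate i y))"
      using that by (simp add: fibre_windows_def translate_Y)
    ultimately have "window (Suc K) (translate i y) \<in> fibre_windows (Suc K) (translate i x)"
      by simp
    then obtain z where z: "z \<in> Y" "\<pi> z = translate i x" "agree (Suc K) (translate i y) z"
      unfolding fibre_windows_def agree_iff_window by blast
    have "\<pi> (translate (- i) z) = x" using z by (simp add: pi_translate)
    moreover have "agree (Suc K) (translate i y) (translate i (translate (- i) z))"
      using z(3) by simp
    then have "agree_on {i - int K - 1..i + int K + 1} y (translate (- i) z)"
      unfolding agree_translate_iff by (rule agree_on_mono) auto
    ultimately show ?thesis using translate_Y[OF z(1)] by blast
  qed
  ultimately show ?thesis by blast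
qed

text \<open>A half-line contains a window of the separating radius, and one such window already
  decides equality in a fibre.\<close>

lemma left_asymptotic_eqI:
  assumes "y \<in> Y" "z \<in> Y" "\<pi> y = \<pi> z" "left_asymptotic y z"
  shows "y = z"
proof -
  obtain K :: nat where K: "\<And>i. agree_on {i - int K..i + int K} y z \<Longrightarrow> y = z"
    using uniform_separation_lift assms by metis
  obtain a where "agree_on {..a} y z" using assms(4) by (auto simp: left_asymptotic_def)
  then have "agree_on {(a - int K) - int K..(a - int K) + int K} y z" by (rule agree_on_mono) auto
  then show ?thesis by (rule K)
qed

lemma right_asymptotic_eqI:
  assumes "y \<in> Y" "z \<in> Y" "\<pi> y = \<pi> z" "right_asymptotic y z"
  shows "y = z"
proof -
  obtain K :: nat where K: "\<And>i. agree_on {i - int K..i + int K} y z \<Longrightarrow> y = z"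
    using uniform_separation_lift assms by metis
  obtain a where "agree_on {a..} y z" using assms(4) by (auto simp: right_asymptotic_def)
  then have "agree_on {(a + int K) - int K..(a + int K) + int K} y z" by (rule agree_on_mono) auto
  then show ?thesis by (rule K)
qed

text \<open>Some lift of \<open>\<pi> z\<close> agrees with \<open>y\<close> to radius
  \<open>K + 1\<close> about \<open>i\<close>. It agrees with \<open>z\<close> to radius
  \<open>K\<close>, so by separation it is \<open>z\<close>. Thus an agreement grows by one
  coordinate on each side wherever the base points agree.\<close>

lemma uniform_extension:
  "\<exists>K L::nat.
    (\<forall>y\<in>Y. \<forall>x\<in>X. \<forall>i. agree_on {i - int L..i + int L} (\<pi> y) x \<longrightarrow>
      (\<exists>z\<in>Y. \<pi> z = x \<and> agree_on {i - int K..i + int K} y z)) \<and>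
    (\<forall>y\<in>Y. \<forall>z\<in>Y. \<forall>i. agree_on {i - int K..i + int K} y z \<and>
      agree_on {i - int L..i + int L} (\<pi> y) (\<pi> z) \<longrightarrow>
      agree_on {i - int K - 1..i + int K + 1} y z)"
proof -
  obtain K L :: nat where
    sep: "\<And>y z i. y \<in> Y \<Longrightarrow> z \<in> Y \<Longrightarrow> \<pi> y = \<pi> z \<Longrightarrow> agree_on {i - int K..i + int K} y z \<Longrightarrow> y = z" and
    lift: "\<And>y x i. y \<in> Y \<Longrightarrow> x \<in> X \<Longrightarrow> agree_on {i - int L..i + int L} (\<pi> y) x \<Longrightarrow>
      (\<exists>z\<in>Y. \<pi> z = x \<and> agree_on {i - int K - 1..i + int K + 1} y z)"
    using uniform_separation_lift by metis
  have sub: "{i - int K..i + int K} \<subseteq> {i - int K - 1..i + int K + 1}" for i by auto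
  have "agree_on {i - int K - 1..i + int K + 1} y z"
    if yz: "y \<in> Y" "z \<in> Y" "agree_on {i - int K..i + int K} y z"
      "agree_on {i - int L..i + int L} (\<pi> y) (\<pi> z)" for y z i
  proof -
    obtain u where u: "u \<in> Y" "\<pi> u = \<pi> z" "agree_on {i - int K - 1..i + int K + 1} y u"
      using lift[OF yz(1) maps_to[OF yz(2)] yz(4)] by blast
    have "agree_on {i - int K..i + int K} u z"
      using agree_on_trans[OF agree_on_sym[OF agree_on_mono[OF u(3) sub]] yz(3)] .
    then have "u = z" using sep u(1,2) yz(2) by blast
    then show ?thesis using u(3) by simp
  qed
  moreover have "\<exists>z\<in>Y. \<pi> z = x \<and> agree_on {i - int K..i + int K} y z"
    if "y \<in> Y" "x \<in> X" "agree_on {i - int L..i + int L} (\<pi> y) x" for y x i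
    using lift[OF that] agree_on_mono[OF _ sub] by blast
  ultimately show ?thesis by blast
qed

text \<open>A lift that agrees with \<open>y\<close> on one window far enough to the left suffices:
  the base points agree from there on, so the agreement propagates leftwards without end.\<close>

lemma left_asymptotic_lift:
  assumes y: "y \<in> Y" and x: "x \<in> X" and as: "left_asymptotic (\<pi> y) x"
  shows "\<exists>z\<in>Y. \<pi> z = x \<and> left_asymptotic y z"
proof -
  obtain K L :: nat where
    lift: "\<And>i. agree_on {i - int L..i + int L} (\<pi> y) x \<Longrightarrow>
      (\<exists>z\<in>Y. \<pi> z = x \<and> agree_on {i - int K..i + int K} y z)" and
    ext: "\<And>z i. z \<in> Y \<Longrightarrow> agree_on {i - int K..i + int K} y z \<Longrightarrow>
      agree_on {i - int L..i + int L} (\<pi> y) (\<pi> z) \<Longrightarrow> agree_on {i - int K - 1..i + int K + 1} y z"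
    using uniform_extension y x by metis
  obtain a where "agree_on {..a} (\<pi> y) x" using as by (auto simp: left_asymptotic_def)
  then have a: "agree_on {i - int L..i + int L} (\<pi> y) x" if "i \<le> a - int L" for i
    by (rule agree_on_mono) (use that in auto)
  \<comment> \<open>The last centre whose window of radius \<open>L\<close> lies in the half-line of
    agreement.\<close>
  define i where "i = a - int L"
  obtain z where z: "z \<in> Y" "\<pi> z = x" "agree_on {i - int K..i + int K} y z"
    using lift[OF a] i_def by blast
  have "agree_on {i - int n - int K..i + int K} y z" for n
  proof (induction n)
    case 0
    then show ?case using z(3) by simp
  next
    case (Suc n)
    have "agree_on {(i - int n) - int K..(i - int n) + int K} y z"
      by (rule agree_on_mono[OF Suc]) auto
    then have "agree_on {(i - int n) - int K - 1..(i - int n) + int K + 1} y z"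
      using ext z(1,2) a[of "i - int n"] by (simp add: i_def)
    moreover have "{i - int (Suc n) - int K..i + int K} \<subseteq>
        {(i - int n) - int K - 1..(i - int n) + int K + 1} \<union> {i - int n - int K..i + int K}"
      by auto
    ultimately show ?case using Suc unfolding agree_on_def by blast
  qed
  note all = this
  have "agree_on {..i + int K} y z"
    unfolding agree_on_def
  proof
    fix j assume j: "j \<in> {..i + int K}"
    have "j \<in> {i - int (nat \<bar>i - j\<bar>) - int K..i + int K}" using j by auto
    then show "y j = z j" using all unfolding agree_on_def by blast
  qed
  then show ?thesis using z by (auto simp: left_asymptotic_def)
qed

lemma right_asymptotic_lift:
  assumes y: "y \<in> Y" and x: "x \<in> X" and as: "right_asymptotic (\<pi> y) x"
  shows "\<exists>z\<in>Y. \<pi> z = x \<and> right_asymptotic y z"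
proof -
  obtain K L :: nat where
    lift: "\<And>i. agree_on {i - int L..i + int L} (\<pi> y) x \<Longrightarrow>
      (\<exists>z\<in>Y. \<pi> z = x \<and> agree_on {i - int K..i + int K} y z)" and
    ext: "\<And>z i. z \<in> Y \<Longrightarrow> agree_on {i - int K..i + int K} y z \<Longrightarrow>
      agree_on {i - int L..i + int L} (\<pi> y) (\<pi> z) \<Longrightarrow> agree_on {i - int K - 1..i + int K + 1} y z"
    using uniform_extension y x by metis
  obtain a where "agree_on {a..} (\<pi> y) x" using as by (auto simp: right_asymptotic_def)
  then have a: "agree_on {i - int L..i + int L} (\<pi> y) x" if "i \<ge> a + int L" for i
    by (rule agree_on_mono) (use that in auto)
  define i where "i = a + int L"
  obtain z where z: "z \<in> Y" "\<pi> z = x" "agree_on {i - int K..i + int K} y z"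
    using lift[OF a] i_def by blast
  have "agree_on {i - int K..i + int n + int K} y z" for n
  proof (induction n)
    case 0
    then show ?case using z(3) by simp
  next
    case (Suc n)
    have "agree_on {(i + int n) - int K..(i + int n) + int K} y z"
      by (rule agree_on_mono[OF Suc]) auto
    then have "agree_on {(i + int n) - int K - 1..(i + int n) + int K + 1} y z"
      using ext z(1,2) a[of "i + int n"] by (simp add: i_def)
    moreover have "{i - int K..i + int (Suc n) + int K} \<subseteq>
        {(i + int n) - int K - 1..(i + int n) + int K + 1} \<union> {i - int K..i + int n + int K}"
      by auto
    ultimately show ?case using Suc unfolding agree_on_def by blast
  qed
  note all = this
  have "agree_on {i - int K..} y z"
    unfolding agree_on_def
  proof
    fix j assume j: "j \<in> {i - int K..}"
    have "j \<in> {i - int K..i + int (nat \<bar>i - j\<bar>) + int K}" using j by auto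
    then show "y j = z j" using all unfolding agree_on_def by blast
  qed
  then show ?thesis using z by (auto simp: right_asymptotic_def)
qed

section \<open>The bijection of fibres along a connecting point\<close>

lemma lifts_path_exists:
  assumes "y \<in> Y" "t \<in> X" "x' \<in> X"
    and "left_asymptotic (\<pi> y) t" "right_asymptotic t (translate n x')"
  shows "\<exists>y'\<in>Y. \<pi> y' = x' \<and> lifts_path Y \<pi> t n y y'"
proof -
  obtain s where s: "s \<in> Y" "\<pi> s = t" "left_asymptotic y s"
    using left_asymptotic_lift assms by blast
  obtain z where z: "z \<in> Y" "\<pi> z = translate n x'" "right_asymptotic s z"
    using right_asymptotic_lift[OF s(1) translate_X[OF assms(3)]] s(2) assms(5) by blast
  have "\<pi> (translate (- n) z) = x'" using z by (simp add: pi_translate)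
  moreover have "lifts_path Y \<pi> t n y (translate (- n) z)"
    unfolding lifts_path_def using s z by auto
  ultimately show ?thesis using translate_Y z(1) by blast
qed

lemma lifts_path_exists_reverse:
  assumes "y' \<in> Y" "t \<in> X" "x \<in> X"
    and "left_asymptotic x t" "right_asymptotic t (translate n (\<pi> y'))"
  shows "\<exists>y\<in>Y. \<pi> y = x \<and> lifts_path Y \<pi> t n y y'"
proof -
  have "right_asymptotic (\<pi> (translate n y')) t"
    using assms right_asymptotic_sym by (simp add: pi_translate)
  then obtain s where s: "s \<in> Y" "\<pi> s = t" "right_asymptotic (translate n y') s"
    using right_asymptotic_lift[OF translate_Y[OF assms(1)] assms(2)] by blast
  obtain y where y: "y \<in> Y" "\<pi> y = x" "left_asymptotic s y"
    using left_asymptotic_lift[OF s(1) assms(3)] s(2) assms(4) left_asymptotic_sym by blast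
  then show ?thesis
    unfolding lifts_path_def using s left_asymptotic_sym right_asymptotic_sym by blast
qed

text \<open>The left tail of \<open>y\<close> determines the lift of \<open>t\<close>, and the right
  tail of that lift determines the right end. The reverse lemma reads the same argument from right
  to left.\<close>

lemma lifts_path_unique:
  assumes "lifts_path Y \<pi> t n y y'" "lifts_path Y \<pi> t n y z'"
    and "y' \<in> Y" "z' \<in> Y" "\<pi> y' = \<pi> z'"
  shows "y' = z'"
proof -
  obtain s where s: "s \<in> Y" "\<pi> s = t" "left_asymptotic y s" "right_asymptotic s (translate n y')"
    using assms(1) unfolding lifts_path_def by blast
  obtain s' where s': "s' \<in> Y" "\<pi> s' = t" "left_asymptotic y s'" "right_asymptotic s' (translate n z')"
    using assms(2) unfolding lifts_path_def by blast
  have "s = s'"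
    using left_asymptotic_eqI[OF s(1) s'(1)] s s' left_asymptotic_sym left_asymptotic_trans by metis
  then have "right_asymptotic (translate n y') (translate n z')"
    using s(4) s'(4) right_asymptotic_sym right_asymptotic_trans by blast
  then have "translate n y' = translate n z'"
    by (intro right_asymptotic_eqI) (simp_all add: assms translate_Y pi_translate)
  then show ?thesis by (rule translate_cancel)
qed

lemma lifts_path_unique_reverse:
  assumes "lifts_path Y \<pi> t n y y'" "lifts_path Y \<pi> t n z y'"
    and "y \<in> Y" "z \<in> Y" "\<pi> y = \<pi> z"
  shows "y = z"
proof -
  obtain s where s: "s \<in> Y" "\<pi> s = t" "left_asymptotic y s" "right_asymptotic s (translate n y')"
    using assms(1) unfolding lifts_path_def by blast
  obtain s' where s': "s' \<in> Y" "\<pi> s' = t" "left_asymptotic z s'" "right_asymptotic s' (translate n y')"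
    using assms(2) unfolding lifts_path_def by blast
  have "s = s'"
    using right_asymptotic_eqI[OF s(1) s'(1)] s s' right_asymptotic_sym right_asymptotic_trans by metis
  then have "left_asymptotic y z"
    using s(3) s'(3) left_asymptotic_sym left_asymptotic_trans by blast
  then show ?thesis by (intro left_asymptotic_eqI) (simp_all add: assms)
qed

text \<open>Two points of an irreducible cover are joined by a path, so a code over \<open>X\<close> is determined by
  its value at one point.\<close>

lemma code_over_eqI:
  assumes Z: "irreducible_sft C Z" and f: "sliding_block_code Z Y f" and g: "sliding_block_code Z Y g"
    and over: "\<And>z. z \<in> Z \<Longrightarrow> \<pi> (f z) = \<pi> (g z)" and p: "p \<in> Z" "f p = g p"
  shows "f = g"
proof
  have sZ: "shift_space C Z" using Z by (rule irreducible_sft_shift_space)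
  have ext: "f \<in> Z \<rightarrow>\<^sub>E Y" "g \<in> Z \<rightarrow>\<^sub>E Y" using f g by (auto simp: sliding_block_code_def)
  fix z
  show "f z = g z"
  proof (cases "z \<in> Z")
    case False
    then show ?thesis using ext by (metis PiE_arb)
  next
    case True
    obtain t n where t: "t \<in> Z" "left_asymptotic p t" "right_asymptotic t (translate n z)"
      using irreducible_connecting_point[OF Z p(1) True] by blast
    \<comment> \<open>The joining point \<open>t\<close> of \<open>Z\<close> is read as a path over
      \<open>\<pi> (f t)\<close>. On \<open>Z\<close> the maps \<open>\<pi> \<circ> f\<close> and
      \<open>\<pi> \<circ> g\<close> coincide, so both codes turn it into lifts of one path from the
      common start \<open>f p\<close>, and their ends must agree.\<close>
    have path: "lifts_path Z (\<lambda>z. \<pi> (f z)) (\<pi> (f t)) n p z" using t unfolding lifts_path_def by blast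
    have "lifts_path Y \<pi> (\<pi> (f t)) n (f p) (f z)"
      by (rule lifts_path_map[OF sZ f _ p(1) True path]) simp
    moreover have "lifts_path Y \<pi> (\<pi> (f t)) n (f p) (g z)"
      unfolding p(2) by (rule lifts_path_map[OF sZ g _ p(1) True path]) (simp add: over)
    ultimately show ?thesis
      by (rule lifts_path_unique) (use ext True over in auto)
  qed
qed

end

section \<open>Conjugacies and Galois groups\<close>

lemma sliding_block_codeD:
  assumes "sliding_block_code Y X f"
  shows "\<And>y. y \<in> Y \<Longrightarrow> f y \<in> X" "f \<in> extensional Y"
    "continuous_map (shift_topology Y) (shift_topology X) f"
    "\<And>y. y \<in> Y \<Longrightarrow> f (shift y) = shift (f y)"
  using assms by (auto simp: sliding_block_code_def PiE_def)

lemma sliding_block_code_compose: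
  assumes Z: "shift ` Z = Z" and f: "sliding_block_code Y X f" and g: "sliding_block_code Z Y g"
  shows "sliding_block_code Z X (\<lambda>z\<in>Z. f (g z))"
proof -
  note f = sliding_block_codeD[OF f] and g = sliding_block_codeD[OF g]
  have "continuous_map (shift_topology Z) (shift_topology X) (\<lambda>z\<in>Z. f (g z))"
    by (rule continuous_map_eq[OF continuous_map_compose[OF g(3) f(3)]]) simp
  moreover have "shift z \<in> Z" if "z \<in> Z" for z using Z that by blast
  ultimately show ?thesis
    using f g by (auto simp: sliding_block_code_def)
qed

lemma topological_conjugacyD:
  assumes "topological_conjugacy Y X f"
  shows "sliding_block_code Y X f" "inj_on f Y" "f ` Y = X"
  using assms by (auto simp: topological_conjugacy_def bij_betw_def)

lemma topological_conjugacy_id: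
  assumes "shift ` Y = Y"
  shows "topological_conjugacy Y Y (\<lambda>y\<in>Y. y)"
proof -
  have "continuous_map (shift_topology Y) (shift_topology Y) (\<lambda>y\<in>Y. y)"
    by (rule continuous_map_eq[OF continuous_map_id]) simp
  moreover have "shift y \<in> Y" if "y \<in> Y" for y using assms that by blast
  ultimately show ?thesis
    by (auto simp: topological_conjugacy_def sliding_block_code_def bij_betw_def inj_on_def)
qed

lemma topological_conjugacy_compose:
  assumes Z: "shift ` Z = Z" and f: "topological_conjugacy Y X f" and g: "topological_conjugacy Z Y g"
  shows "topological_conjugacy Z X (\<lambda>z\<in>Z. f (g z))"
proof -
  have "bij_betw (f \<circ> g) Z X"
    using f g bij_betw_trans by (auto simp: topological_conjugacy_def)
  then have "bij_betw (\<lambda>z\<in>Z. f (g z)) Z X"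
    by (subst bij_betw_cong[of Z _ "f \<circ> g"]) auto
  then show ?thesis
    using sliding_block_code_compose[OF Z, of Y X f g] f g by (simp add: topological_conjugacy_def)
qed

text \<open>A continuous bijection from a compact space to a Hausdorff space is a homeomorphism. Its
  inverse is restricted to \<open>X\<close> because codes are \<open>undefined\<close> outside their
  domain.\<close>

lemma topological_conjugacy_inverse:
  assumes Y: "shift_space B Y" and f: "topological_conjugacy Y X f"
  shows "topological_conjugacy X Y (\<lambda>x\<in>X. inv_into Y f x)"
proof -
  note sb = sliding_block_codeD[OF topological_conjugacyD(1)[OF f]] and f = topological_conjugacyD[OF f]
  have mem: "inv_into Y f x \<in> Y" if "x \<in> X" for x
    using f(3) that by (simp add: inv_into_into)
  have right: "f (inv_into Y f x) = x" if "x \<in> X" for x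
    using f(3) that by (simp add: f_inv_into_f)
  have left: "inv_into Y f (f y) = y" if "y \<in> Y" for y
    using f(2) that by simp
  have "homeomorphic_map (shift_topology Y) (shift_topology X) f"
    using continuous_imp_homeomorphic_map[OF sb(3) compact_shift_topology[OF Y] Hausdorff_shift_topology]
      f(2,3) by simp
  then obtain g where g: "homeomorphic_maps (shift_topology Y) (shift_topology X) f g"
    by (auto simp: homeomorphic_map_maps)
  then have "continuous_map (shift_topology X) (shift_topology Y) g"
    by (simp add: homeomorphic_maps_def)
  moreover have "g x = (\<lambda>x\<in>X. inv_into Y f x) x" if "x \<in> X" for x
  proof -
    have "g (f (inv_into Y f x)) = inv_into Y f x"
      using g mem[OF that] by (simp add: homeomorphic_maps_def)
    then show ?thesis using right[OF that] that by simp
  qed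
  ultimately have "continuous_map (shift_topology X) (shift_topology Y) (\<lambda>x\<in>X. inv_into Y f x)"
    using continuous_map_eq[of "shift_topology X" "shift_topology Y" g] by simp
  moreover have "inv_into Y f (shift x) = shift (inv_into Y f x) \<and> shift x \<in> X" if "x \<in> X" for x
  proof -
    have s: "shift (inv_into Y f x) \<in> Y"
      using shift_space_shift_image[OF Y] mem[OF that] by blast
    have "f (shift (inv_into Y f x)) = shift x"
      using sb(4)[OF mem[OF that]] right[OF that] by simp
    then show ?thesis using left[OF s] sb(1)[OF s] by simp
  qed
  moreover have "bij_betw (\<lambda>x\<in>X. inv_into Y f x) X Y"
    using bij_betw_inv_into[of f Y X] f by (simp add: bij_betw_def inj_on_def)
  ultimately show ?thesis
    using mem by (auto simp: topological_conjugacy_def sliding_block_code_def)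
qed

text \<open>Over an empty base every positive number would be a degree; a single fibre makes the
  description in \<open>deg\<close> unique.\<close>

lemma has_degree_deg:
  assumes "has_degree Y X \<pi> d" "X \<noteq> {}"
  shows "deg Y X \<pi> = d"
  unfolding deg_def
proof (rule the_equality[where P = "has_degree Y X \<pi>", OF assms(1)])
  fix e assume "has_degree Y X \<pi> e"
  then show "e = d" using assms by (auto simp: has_degree_def)
qed

lemma topological_conjugacy_unramified:
  assumes "topological_conjugacy Y X f"
  shows "unramified Y X f"
proof -
  note f = topological_conjugacyD[OF assms]
  have "card {y \<in> Y. f y = x} = 1" if "x \<in> X" for x
  proof -
    obtain y where "y \<in> Y" "f y = x" using f(3) \<open>x \<in> X\<close> by blast
    then have "{y \<in> Y. f y = x} = {y}" using f(2) by (auto simp: inj_on_def)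
    then show ?thesis by simp
  qed
  then have "has_degree Y X f 1" by (simp add: has_degree_def)
  then show ?thesis using f by (auto simp: unramified_def factor_map_def)
qed

lemma unramified_compose_right:
  assumes Z: "shift ` Z = Z" and f: "unramified Y X f" and g: "topological_conjugacy Z Y g"
  shows "unramified Z X (\<lambda>z\<in>Z. f (g z))"
proof -
  note g = topological_conjugacyD[OF g]
  obtain d where d: "has_degree Y X f d" and fac: "sliding_block_code Y X f" "f ` Y = X"
    using f by (auto simp: unramified_def factor_map_def)
  have "bij_betw g {z \<in> Z. (\<lambda>z\<in>Z. f (g z)) z = x} {y \<in> Y. f y = x}" for x
    using g by (auto simp: bij_betw_def inj_on_def)
  then have "card {z \<in> Z. (\<lambda>z\<in>Z. f (g z)) z = x} = card {y \<in> Y. f y = x}" for x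
    by (rule bij_betw_same_card)
  then have "has_degree Z X (\<lambda>z\<in>Z. f (g z)) d"
    using d unfolding has_degree_def by presburger
  moreover have "(\<lambda>z\<in>Z. f (g z)) ` Z = X"
    using g(3) fac(2) by (force simp: image_iff)
  ultimately show ?thesis
    using sliding_block_code_compose[OF Z fac(1) g(1)] by (auto simp: unramified_def factor_map_def)
qed

lemma unramified_compose_left:
  assumes Y: "shift ` Y = Y" and f: "topological_conjugacy X X' f" and g: "factor_map Y X g" "has_degree Y X g d"
  shows "factor_map Y X' (\<lambda>y\<in>Y. f (g y)) \<and> has_degree Y X' (\<lambda>y\<in>Y. f (g y)) d"
proof -
  note f = topological_conjugacyD[OF f]
  have fac: "sliding_block_code Y X g" "g ` Y = X"
    using g by (auto simp: factor_map_def)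
  have "card {y \<in> Y. (\<lambda>y\<in>Y. f (g y)) y = x'} = d" if "x' \<in> X'" for x'
  proof -
    obtain x where x: "x \<in> X" "f x = x'" using f(3) \<open>x' \<in> X'\<close> by blast
    have "{y \<in> Y. (\<lambda>y\<in>Y. f (g y)) y = x'} = {y \<in> Y. g y = x}"
      using x f(2) fac(2) by (auto simp: inj_on_def)
    then show ?thesis using g(2) x(1) by (simp add: has_degree_def)
  qed
  moreover have "(\<lambda>y\<in>Y. f (g y)) ` Y = X'"
    using f(3) fac(2) by (force simp: image_iff)
  ultimately show ?thesis
    using sliding_block_code_compose[OF Y f(1) fac(1)] g(2) by (simp add: factor_map_def has_degree_def)
qed

section \<open>Galois groups and their action on fibres\<close>

lemma Aut_overD:
  assumes "\<phi> \<in> Aut_over Y \<pi>"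
  shows "sliding_block_code Y Y \<phi>" "\<phi> \<in> Bij Y" "\<phi> \<in> extensional Y" "inj_on \<phi> Y" "\<phi> ` Y = Y"
    "\<And>y. y \<in> Y \<Longrightarrow> \<phi> y \<in> Y" "\<And>y. y \<in> Y \<Longrightarrow> \<pi> (\<phi> y) = \<pi> y"
  using assms sliding_block_codeD(2)[of Y Y \<phi>]
  by (auto simp: Aut_over_def topological_conjugacy_def bij_betw_def Bij_def)

lemma carrier_Gal [simp]: "carrier (Gal Y \<pi>) = Aut_over Y \<pi>"
  by (simp add: Gal_def)

lemma mult_Gal:
  assumes "\<phi> \<in> Aut_over Y \<pi>" "\<psi> \<in> Aut_over Y \<pi>"
  shows "\<phi> \<otimes>\<^bsub>Gal Y \<pi>\<^esub> \<psi> = (\<lambda>y\<in>Y. \<phi> (\<psi> y))"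
  using Aut_overD(2)[OF assms(1)] Aut_overD(2)[OF assms(2)]
  by (simp add: Gal_def BijGroup_def compose_def)

lemma Aut_over_compose:
  assumes Y: "shift ` Y = Y" and "\<phi> \<in> Aut_over Y \<pi>" "\<psi> \<in> Aut_over Y \<pi>"
  shows "(\<lambda>y\<in>Y. \<phi> (\<psi> y)) \<in> Aut_over Y \<pi>"
  using topological_conjugacy_compose[OF Y, of Y Y \<phi> \<psi>] Aut_overD[OF assms(2)] Aut_overD[OF assms(3)] assms(2,3)
  by (auto simp: Aut_over_def)

text \<open>The hypothesis on the projections leaves room for a conjugacy between the base shifts.\<close>

lemma conjugation_iso:
  assumes Y: "shift_space B Y" and \<gamma>: "topological_conjugacy Y Y' \<gamma>"
    and fibres: "\<And>y z. y \<in> Y \<Longrightarrow> z \<in> Y \<Longrightarrow> \<pi> y = \<pi> z \<longleftrightarrow> \<pi>' (\<gamma> y) = \<pi>' (\<gamma> z)"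
  shows "(\<lambda>\<phi>. \<lambda>y\<in>Y'. \<gamma> (\<phi> (inv_into Y \<gamma> y))) \<in> iso (Gal Y \<pi>) (Gal Y' \<pi>')"
proof -
  let ?\<delta> = "\<lambda>y\<in>Y'. inv_into Y \<gamma> y"
  note g = topological_conjugacyD[OF \<gamma>]
  have \<delta>: "topological_conjugacy Y' Y ?\<delta>" by (rule topological_conjugacy_inverse[OF Y \<gamma>])
  have invY: "shift ` Y = Y" using Y by (rule shift_space_shift_image)
  have invY': "shift ` Y' = Y'"
  proof -
    have "shift ` Y' = (\<lambda>y. \<gamma> (shift y)) ` Y"
      using sliding_block_codeD(4)[OF g(1)] g(3) by (force simp: image_image)
    also have "\<dots> = \<gamma> ` (shift ` Y)" by (simp add: image_image)
    finally show ?thesis using invY g(3) by simp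
  qed
  have mem: "inv_into Y \<gamma> y \<in> Y" "\<gamma> (inv_into Y \<gamma> y) = y" if "y \<in> Y'" for y
    using g(3) that by (simp_all add: inv_into_into f_inv_into_f)
  have left: "inv_into Y \<gamma> (\<gamma> y) = y" "\<gamma> y \<in> Y'" if "y \<in> Y" for y
    using g(2,3) that by auto
  define k where "k = (\<lambda>\<phi>. \<lambda>y\<in>Y'. \<gamma> (\<phi> (inv_into Y \<gamma> y)))"
  define l where "l = (\<lambda>\<psi>. \<lambda>y\<in>Y. inv_into Y \<gamma> (\<psi> (\<gamma> y)))"
  have k: "k \<phi> \<in> Aut_over Y' \<pi>'" if \<phi>: "\<phi> \<in> Aut_over Y \<pi>" for \<phi>
  proof -
    note a = Aut_overD[OF \<phi>]
    have "topological_conjugacy Y Y \<phi>" using \<phi> by (simp add: Aut_over_def)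
    then have "topological_conjugacy Y' Y' (\<lambda>y\<in>Y'. \<gamma> ((\<lambda>y\<in>Y'. \<phi> (?\<delta> y)) y))"
      by (intro topological_conjugacy_compose[OF invY' \<gamma>] topological_conjugacy_compose[OF invY' _ \<delta>])
    moreover have "(\<lambda>y\<in>Y'. \<gamma> ((\<lambda>y\<in>Y'. \<phi> (?\<delta> y)) y)) = k \<phi>"
      by (simp add: k_def cong: restrict_cong)
    moreover have "\<pi>' (k \<phi> y) = \<pi>' y" if "y \<in> Y'" for y
      using fibres[of "\<phi> (inv_into Y \<gamma> y)" "inv_into Y \<gamma> y"] a mem that by (simp add: k_def)
    ultimately show ?thesis by (simp add: Aut_over_def)
  qed
  have l: "l \<psi> \<in> Aut_over Y \<pi>" if \<psi>: "\<psi> \<in> Aut_over Y' \<pi>'" for \<psi>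
  proof -
    note a = Aut_overD[OF \<psi>]
    have "topological_conjugacy Y' Y' \<psi>" using \<psi> by (simp add: Aut_over_def)
    then have "topological_conjugacy Y Y (\<lambda>y\<in>Y. ?\<delta> ((\<lambda>y\<in>Y. \<psi> (\<gamma> y)) y))"
      by (intro topological_conjugacy_compose[OF invY \<delta>] topological_conjugacy_compose[OF invY _ \<gamma>])
    moreover have "(\<lambda>y\<in>Y. ?\<delta> ((\<lambda>y\<in>Y. \<psi> (\<gamma> y)) y)) = l \<psi>"
      using a(6) left(2) by (simp add: l_def cong: restrict_cong)
    moreover have "\<pi> (l \<psi> y) = \<pi> y" if "y \<in> Y" for y
      using fibres[of "l \<psi> y" y] a mem left that by (simp add: l_def)
    ultimately show ?thesis by (simp add: Aut_over_def)
  qed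
  have "bij_betw k (Aut_over Y \<pi>) (Aut_over Y' \<pi>')"
  proof (rule bij_betw_byWitness[of _ l])
    show "\<forall>\<phi>\<in>Aut_over Y \<pi>. l (k \<phi>) = \<phi>"
    proof
      fix \<phi> assume \<phi>: "\<phi> \<in> Aut_over Y \<pi>"
      show "l (k \<phi>) = \<phi>"
        by (rule extensionalityI[of _ Y])
          (use Aut_overD[OF \<phi>] left in \<open>simp_all add: l_def k_def\<close>)
    qed
    show "\<forall>\<psi>\<in>Aut_over Y' \<pi>'. k (l \<psi>) = \<psi>"
    proof
      fix \<psi> assume \<psi>: "\<psi> \<in> Aut_over Y' \<pi>'"
      show "k (l \<psi>) = \<psi>"
        by (rule extensionalityI[of _ Y'])
          (use Aut_overD[OF \<psi>] mem in \<open>simp_all add: l_def k_def\<close>)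
    qed
  qed (use k l in auto)
  moreover have "k \<in> hom (Gal Y \<pi>) (Gal Y' \<pi>')"
  proof (rule homI)
    fix \<phi> \<psi> assume "\<phi> \<in> carrier (Gal Y \<pi>)" "\<psi> \<in> carrier (Gal Y \<pi>)"
    then have a: "\<phi> \<in> Aut_over Y \<pi>" "\<psi> \<in> Aut_over Y \<pi>" by simp_all
    have "k (\<lambda>y\<in>Y. \<phi> (\<psi> y)) = (\<lambda>y\<in>Y'. k \<phi> (k \<psi> y))"
      using mem left Aut_overD(6)[OF a(2)] by (simp add: k_def cong: restrict_cong)
    then show "k (\<phi> \<otimes>\<^bsub>Gal Y \<pi>\<^esub> \<psi>) = k \<phi> \<otimes>\<^bsub>Gal Y' \<pi>'\<^esub> k \<psi>"
      using a k by (simp add: mult_Gal)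
  qed (use k in simp)
  ultimately have "k \<in> iso (Gal Y \<pi>) (Gal Y' \<pi>')" by (simp add: iso_def)
  then show ?thesis by (simp add: k_def)
qed

text \<open>An automorphism over \<open>X\<close> is in particular a code over \<open>X\<close>, so
  \<open>code_over_eqI\<close> applies: the action on fibres is free.\<close>

lemma (in constant_to_one) Aut_over_eqI:
  assumes Yi: "irreducible_sft B Y" and \<phi>: "\<phi> \<in> Aut_over Y \<pi>" and \<psi>: "\<psi> \<in> Aut_over Y \<pi>"
    and y: "y \<in> Y" "\<phi> y = \<psi> y"
  shows "\<phi> = \<psi>"
proof (rule code_over_eqI[OF Yi, where f = \<phi> and g = \<psi> and p = y])
  show "sliding_block_code Y Y \<phi>" "sliding_block_code Y Y \<psi>"
    using \<phi> \<psi> by (simp_all add: Aut_overD(1))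
  show "\<pi> (\<phi> z) = \<pi> (\<psi> z)" if "z \<in> Y" for z
    using Aut_overD(7)[OF \<phi> that] Aut_overD(7)[OF \<psi> that] by simp
  show "y \<in> Y" "\<phi> y = \<psi> y" by (rule y)+
qed

text \<open>Evaluation at \<open>y\<close> embeds the group in the fibre through \<open>y\<close> by
  freeness; both have \<open>d\<close> elements, so every point of the fibre is reached.\<close>

lemma (in constant_to_one) Aut_over_transitive:
  assumes Yi: "irreducible_sft B Y" and card: "card (Aut_over Y \<pi>) = d"
    and y: "y \<in> Y" "z \<in> Y" "\<pi> y = \<pi> z"
  shows "\<exists>\<phi>\<in>Aut_over Y \<pi>. \<phi> y = z"
proof -
  let ?e = "\<lambda>\<phi>. \<phi> y"
  have "inj_on ?e (Aut_over Y \<pi>)"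
    using Aut_over_eqI[OF Yi _ _ y(1)] by (intro inj_onI)
  then have "card (?e ` Aut_over Y \<pi>) = card (fibre (\<pi> y))"
    using card card_fibre[OF maps_to[OF y(1)]] by (simp add: card_image)
  moreover have "?e ` Aut_over Y \<pi> \<subseteq> fibre (\<pi> y)"
    using Aut_overD(6)[of _ Y \<pi> y] Aut_overD(7)[of _ Y \<pi> y] y(1) by (auto simp del: mem_Collect_eq intro!: CollectI)
  ultimately have "?e ` Aut_over Y \<pi> = fibre (\<pi> y)"
    using card_subset_eq finite_fibre[OF maps_to[OF y(1)]] by blast
  then have "z \<in> ?e ` Aut_over Y \<pi>" using y by simp
  then show ?thesis by blast
qed

section \<open>Pointed Galois factors and their transition maps\<close>

lemma pointed_galois_factorE:
  assumes X: "irreducible_sft A X" and c: "c \<in> pointed_galois_factors X x0"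
  obtains B d where "irreducible_sft B (cover c)" "constant_to_one A X B (cover c) (proj c) d"
    "card (Aut_over (cover c) (proj c)) = d" "basept c \<in> cover c" "proj c (basept c) = x0"
proof -
  obtain B where B: "irreducible_sft B (cover c)" "galois_factor (cover c) X (proj c)"
      "basept c \<in> cover c" "proj c (basept c) = x0"
    using c by (auto simp: pointed_galois_factors_def)
  then obtain d where d: "has_degree (cover c) X (proj c) d" "factor_map (cover c) X (proj c)"
    by (auto simp: galois_factor_def unramified_def)
  have "X \<noteq> {}" using irreducible_sft_shift_space[OF X] by (simp add: shift_space_def)
  then have "card (Aut_over (cover c) (proj c)) = d"
    using has_degree_deg[OF d(1)] B(2) by (simp add: galois_factor_def)
  moreover have "constant_to_one A X B (cover c) (proj c) d"
    using X B(1) d by (simp add: constant_to_one_def irreducible_sft_def)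
  ultimately show thesis using that B by blast
qed

lemma transition_code:
  assumes "transition c d \<alpha>"
  shows "sliding_block_code (cover d) (cover c) \<alpha>" "\<And>y. y \<in> cover d \<Longrightarrow> \<alpha> y \<in> cover c"
    "\<alpha> ` cover d = cover c" "\<And>y. y \<in> cover d \<Longrightarrow> proj c (\<alpha> y) = proj d y" "\<alpha> (basept d) = basept c"
  using assms by (auto simp: transition_def unramified_def factor_map_def)

lemma transition_unique:
  assumes X: "irreducible_sft A X" and c: "c \<in> pointed_galois_factors X x0"
    and d: "d \<in> pointed_galois_factors X x0" and \<alpha>: "transition c d \<alpha>" and \<beta>: "transition c d \<beta>"
  shows "\<alpha> = \<beta>"
proof -
  obtain B n where C: "constant_to_one A X B (cover c) (proj c) n"
    using pointed_galois_factorE[OF X c] by blast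
  obtain D where D: "irreducible_sft D (cover d)" "basept d \<in> cover d"
    using pointed_galois_factorE[OF X d] by blast
  show ?thesis
    by (rule constant_to_one.code_over_eqI[where f = \<alpha> and g = \<beta> and p = "basept d", OF C D(1) transition_code(1)[OF \<alpha>] transition_code(1)[OF \<beta>] _ D(2)])
      (simp_all add: transition_code[OF \<alpha>] transition_code[OF \<beta>])
qed

text \<open>Transitivity on the fibre yields a \<open>\<psi>\<close> with the right value at the
  image of the base point. Then \<open>\<psi> \<circ> \<alpha>\<close> and
  \<open>\<alpha> \<circ> \<phi>\<close> are codes over \<open>X\<close> that agree at one point,
  hence everywhere. Uniqueness holds because \<open>\<alpha>\<close> is onto.\<close>

lemma restriction_unique_existence:
  assumes X: "irreducible_sft A X" and c: "c \<in> pointed_galois_factors X x0"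
    and d: "d \<in> pointed_galois_factors X x0" and \<alpha>: "transition c d \<alpha>"
    and \<phi>: "\<phi> \<in> Aut_over (cover d) (proj d)"
  shows "\<exists>!\<psi>. \<psi> \<in> Aut_over (cover c) (proj c) \<and> (\<forall>y\<in>cover d. \<psi> (\<alpha> y) = \<alpha> (\<phi> y))"
proof -
  obtain B n where C: "irreducible_sft B (cover c)" "constant_to_one A X B (cover c) (proj c) n"
      "card (Aut_over (cover c) (proj c)) = n"
    using pointed_galois_factorE[OF X c] by blast
  obtain D where D: "irreducible_sft D (cover d)" "basept d \<in> cover d"
    using pointed_galois_factorE[OF X d] by blast
  have inv: "shift ` cover d = cover d"
    using D(1) irreducible_sft_shift_space shift_space_shift_image by blast
  note a = transition_code[OF \<alpha>] and p = Aut_overD[OF \<phi>]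
  obtain \<psi> where \<psi>: "\<psi> \<in> Aut_over (cover c) (proj c)" "\<psi> (\<alpha> (basept d)) = \<alpha> (\<phi> (basept d))"
    using constant_to_one.Aut_over_transitive[OF C(2,1,3), of "\<alpha> (basept d)" "\<alpha> (\<phi> (basept d))"]
      a(2,4) p(6,7) D(2) by auto
  have "(\<lambda>y\<in>cover d. \<psi> (\<alpha> y)) = (\<lambda>y\<in>cover d. \<alpha> (\<phi> y))"
    by (rule constant_to_one.code_over_eqI[where f = "\<lambda>y\<in>cover d. \<psi> (\<alpha> y)" and
          g = "\<lambda>y\<in>cover d. \<alpha> (\<phi> y)" and p = "basept d", OF C(2) D(1) sliding_block_code_compose[OF inv Aut_overD(1)[OF \<psi>(1)] a(1)]
          sliding_block_code_compose[OF inv a(1) p(1)] _ D(2)])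
      (use a p \<psi> D(2) Aut_overD(7)[OF \<psi>(1)] in simp_all)
  then have "\<psi> (\<alpha> y) = \<alpha> (\<phi> y)" if "y \<in> cover d" for y
    using that by (metis restrict_apply')
  moreover have "\<psi>' = \<psi>''" if "\<psi>' \<in> Aut_over (cover c) (proj c)" "\<psi>'' \<in> Aut_over (cover c) (proj c)"
    "\<forall>y\<in>cover d. \<psi>' (\<alpha> y) = \<alpha> (\<phi> y)" "\<forall>y\<in>cover d. \<psi>'' (\<alpha> y) = \<alpha> (\<phi> y)" for \<psi>' \<psi>''
  proof (rule extensionalityI[of _ "cover c"])
    fix z assume "z \<in> cover c"
    then obtain y where "y \<in> cover d" "z = \<alpha> y" using a(3) by blast
    then show "\<psi>' z = \<psi>'' z" using that by simp
  qed (use that Aut_overD in auto)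
  ultimately show ?thesis using \<psi>(1) by blast
qed

section \<open>Equivalence of pointed Galois factors\<close>

lemma pointed_factor_shift_image:
  assumes "c \<in> pointed_galois_factors X x0"
  shows "shift ` cover c = cover c"
  using assms irreducible_sft_shift_space shift_space_shift_image
  by (fastforce simp: pointed_galois_factors_def)

definition pointed_iso ::
    "'a pointed_factor \<Rightarrow> 'a pointed_factor \<Rightarrow> ((int \<Rightarrow> nat) \<Rightarrow> int \<Rightarrow> nat) \<Rightarrow> bool" where
  "pointed_iso c d \<gamma> \<longleftrightarrow> topological_conjugacy (cover c) (cover d) \<gamma> \<and> \<gamma> (basept c) = basept d \<and>
     (\<forall>y\<in>cover c. proj c y = proj d (\<gamma> y))"

lemma pointed_equiv_iff:
  "(c, d) \<in> pointed_equiv X x0 \<longleftrightarrow>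
     c \<in> pointed_galois_factors X x0 \<and> d \<in> pointed_galois_factors X x0 \<and> (\<exists>\<gamma>. pointed_iso c d \<gamma>)"
  by (simp add: pointed_equiv_def pointed_iso_def)

text \<open>A conjugacy is unramified of degree 1, so an equivalence is a bijective transition;
  whatever is shown for transitions thereby holds for equivalences.\<close>

lemma pointed_iso_iff_transition:
  "pointed_iso c d \<gamma> \<longleftrightarrow> topological_conjugacy (cover c) (cover d) \<gamma> \<and> transition d c \<gamma>"
  using topological_conjugacy_unramified by (auto simp: pointed_iso_def transition_def)

lemma pointed_factor_cover:
  assumes "c \<in> pointed_galois_factors X x0"
  shows "\<exists>B. shift_space B (cover c)" "basept c \<in> cover c"
  using assms irreducible_sft_shift_space by (fastforce simp: pointed_galois_factors_def)+

lemma pointed_iso_inverse: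
  assumes c: "c \<in> pointed_galois_factors X x0" and \<gamma>: "pointed_iso c d \<gamma>"
  shows "pointed_iso d c (\<lambda>y\<in>cover d. inv_into (cover c) \<gamma> y)"
proof -
  obtain B where B: "shift_space B (cover c)" using pointed_factor_cover(1)[OF c] by blast
  have conj: "topological_conjugacy (cover c) (cover d) \<gamma>"
    and base: "\<gamma> (basept c) = basept d" and over: "\<And>y. y \<in> cover c \<Longrightarrow> proj d (\<gamma> y) = proj c y"
    using \<gamma> by (auto simp: pointed_iso_def)
  note g = topological_conjugacyD[OF conj]
  have "inv_into (cover c) \<gamma> (\<gamma> y) = y" "\<gamma> y \<in> cover d" if "y \<in> cover c" for y
    using g(2,3) that by auto
  then have "(\<lambda>y\<in>cover d. inv_into (cover c) \<gamma> y) (basept d) = basept c"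
    using pointed_factor_cover(2)[OF c] base by force
  moreover have "proj d y = proj c (inv_into (cover c) \<gamma> y)" if "y \<in> cover d" for y
    using over[of "inv_into (cover c) \<gamma> y"] g(3) that by (simp add: inv_into_into f_inv_into_f)
  ultimately show ?thesis
    using topological_conjugacy_inverse[OF B conj] by (simp add: pointed_iso_def)
qed

lemma equiv_pointed_equiv: "equiv (pointed_galois_factors X x0) (pointed_equiv X x0)"
proof (rule equivI)
  show "pointed_equiv X x0 \<subseteq> pointed_galois_factors X x0 \<times> pointed_galois_factors X x0"
    by (auto simp: pointed_equiv_def)
  show "refl_on (pointed_galois_factors X x0) (pointed_equiv X x0)"
  proof (rule refl_onI)
    fix c assume c: "c \<in> pointed_galois_factors X x0"
    have "pointed_iso c c (\<lambda>y\<in>cover c. y)"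
      using topological_conjugacy_id[OF pointed_factor_shift_image[OF c]] pointed_factor_cover(2)[OF c]
      by (simp add: pointed_iso_def)
    then show "(c, c) \<in> pointed_equiv X x0" using c by (auto simp: pointed_equiv_iff)
  qed
  show "sym (pointed_equiv X x0)"
    using pointed_iso_inverse by (intro symI) (auto simp: pointed_equiv_iff, blast)
  show "trans (pointed_equiv X x0)"
  proof (rule transI)
    fix c d e assume "(c, d) \<in> pointed_equiv X x0" "(d, e) \<in> pointed_equiv X x0"
    then obtain \<gamma> \<delta> where *: "c \<in> pointed_galois_factors X x0" "e \<in> pointed_galois_factors X x0"
      "pointed_iso c d \<gamma>" "pointed_iso d e \<delta>"
      by (auto simp: pointed_equiv_iff)
    have "\<gamma> y \<in> cover d" if "y \<in> cover c" for y
      using *(3) that by (auto simp: pointed_iso_def topological_conjugacy_def bij_betw_def)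
    then have "pointed_iso c e (\<lambda>y\<in>cover c. \<delta> (\<gamma> y))"
      using * topological_conjugacy_compose[OF pointed_factor_shift_image[OF *(1)], of "cover d" "cover e" \<delta> \<gamma>]
        pointed_factor_cover(2)[OF *(1)]
      by (simp add: pointed_iso_def)
    then show "(c, e) \<in> pointed_equiv X x0" using * by (auto simp: pointed_equiv_iff)
  qed
qed

text \<open>The tool for changing representatives: a transition stays a transition when source and
  target are replaced by equivalent pointed factors.\<close>

lemma transition_conjugate:
  assumes d': "d' \<in> pointed_galois_factors X x0" and \<gamma>: "pointed_iso c c' \<gamma>" and \<delta>: "pointed_iso d' d \<delta>"
    and \<alpha>: "transition c d \<alpha>"
  shows "transition c' d' (\<lambda>y\<in>cover d'. \<gamma> (\<alpha> (\<delta> y)))"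
proof -
  have inv: "shift ` cover d' = cover d'" by (rule pointed_factor_shift_image[OF d'])
  have g: "topological_conjugacy (cover c) (cover c') \<gamma>" and d: "topological_conjugacy (cover d') (cover d) \<delta>"
    using \<gamma> \<delta> by (auto simp: pointed_iso_def)
  have "unramified (cover d') (cover c) (\<lambda>y\<in>cover d'. \<alpha> (\<delta> y))"
    by (rule unramified_compose_right[OF inv _ d]) (use \<alpha> in \<open>simp add: transition_def\<close>)
  then obtain n where "factor_map (cover d') (cover c) (\<lambda>y\<in>cover d'. \<alpha> (\<delta> y))"
    "has_degree (cover d') (cover c) (\<lambda>y\<in>cover d'. \<alpha> (\<delta> y)) n"
    by (auto simp: unramified_def)
  from unramified_compose_left[OF inv g this]
  have "unramified (cover d') (cover c') (\<lambda>y\<in>cover d'. \<gamma> (\<alpha> (\<delta> y)))"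
    by (auto simp: unramified_def cong: restrict_cong)
  moreover have mem: "\<delta> y \<in> cover d" if "y \<in> cover d'" for y
    using topological_conjugacyD(3)[OF d] that by blast
  ultimately show ?thesis
    using \<gamma> \<delta> pointed_factor_cover(2)[OF d'] transition_code(2,4,5)[OF \<alpha>]
    by (simp add: transition_def pointed_iso_def)
qed

section \<open>Threads of the inverse limit, and isomorphisms of limits and of their first
  cohomology\<close>

lemma representative_mem:
  assumes "representatives X x0 R" "i \<in> galois_classes X x0"
  shows "R i \<in> pointed_galois_factors X x0" "R i \<in> i" "i = pointed_equiv X x0 `` {R i}"
proof -
  show "R i \<in> i" using assms by (simp add: representatives_def)
  then show "R i \<in> pointed_galois_factors X x0"
    using assms(2) equiv_pointed_equiv[of X x0] unfolding galois_classes_def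
    by (meson in_quotient_imp_subset subsetD)
  show "i = pointed_equiv X x0 `` {R i}"
    using assms(2) equiv_pointed_equiv[of X x0] \<open>R i \<in> i\<close> unfolding galois_classes_def
    by (metis (no_types, lifting) Image_singleton_iff equiv_class_eq quotientE)
qed

lemma carrier_Gal_at: "carrier (Gal_at R i) = Aut_over (cover (R i)) (proj (R i))"
  by (simp add: Gal_at_def)

text \<open>Eliminates both definite descriptions, \<open>trans_map\<close> and
  \<open>restr_map\<close>. From here on the compatibility of a thread is a commuting square with
  any transition \<open>\<alpha>\<close> at hand.\<close>

lemma restr_map_eq_iff:
  assumes X: "irreducible_sft A X" and R: "representatives X x0 R"
    and i: "i \<in> galois_classes X x0" and j: "j \<in> galois_classes X x0" and \<alpha>: "transition (R i) (R j) \<alpha>"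
    and \<phi>: "\<phi> \<in> carrier (Gal_at R j)" and \<psi>: "\<psi> \<in> carrier (Gal_at R i)"
  shows "restr_map R i j \<phi> = \<psi> \<longleftrightarrow> (\<forall>y\<in>cover (R j). \<psi> (\<alpha> y) = \<alpha> (\<phi> y))"
proof -
  have Ri: "R i \<in> pointed_galois_factors X x0" and Rj: "R j \<in> pointed_galois_factors X x0"
    using representative_mem(1)[OF R] i j by auto
  have tm: "trans_map R i j = \<alpha>"
    unfolding trans_map_def
    using \<alpha> transition_unique[OF X Ri Rj] by (intro the_equality) auto
  let ?P = "\<lambda>\<psi>. \<psi> \<in> carrier (Gal_at R i) \<and> (\<forall>y\<in>cover (R j). \<psi> (\<alpha> y) = \<alpha> (\<phi> y))"
  have "\<exists>!\<psi>. ?P \<psi>"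
    using restriction_unique_existence[OF X Ri Rj \<alpha>] \<phi> by (simp add: carrier_Gal_at)
  moreover have "restr_map R i j \<phi> = (THE \<psi>. ?P \<psi>)"
    by (simp add: restr_map_def tm)
  ultimately have "?P (restr_map R i j \<phi>)" "\<And>\<psi>. ?P \<psi> \<Longrightarrow> \<psi> = restr_map R i j \<phi>"
    using theI'[of ?P] by auto
  then show ?thesis using \<psi> by blast
qed

lemma carrier_abs_galois_group:
  "carrier (abs_galois_group X x0 R) = {g \<in> (\<Pi>\<^sub>E i\<in>galois_classes X x0. carrier (Gal_at R i)).
     \<forall>i\<in>galois_classes X x0. \<forall>j\<in>galois_classes X x0. class_le R i j \<longrightarrow> restr_map R i j (g j) = g i}"
  by (simp add: abs_galois_group_def)

lemma mult_abs_galois_group: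
  "g \<otimes>\<^bsub>abs_galois_group X x0 R\<^esub> h = (\<lambda>i\<in>galois_classes X x0. g i \<otimes>\<^bsub>Gal_at R i\<^esub> h i)"
  by (simp add: abs_galois_group_def product_group_def)

lemma Gal_at_mult:
  assumes R: "representatives X x0 R" and i: "i \<in> galois_classes X x0"
    and "\<phi> \<in> carrier (Gal_at R i)" "\<psi> \<in> carrier (Gal_at R i)"
  shows "\<phi> \<otimes>\<^bsub>Gal_at R i\<^esub> \<psi> = (\<lambda>y\<in>cover (R i). \<phi> (\<psi> y))"
    "\<phi> \<otimes>\<^bsub>Gal_at R i\<^esub> \<psi> \<in> carrier (Gal_at R i)"
proof -
  show *: "\<phi> \<otimes>\<^bsub>Gal_at R i\<^esub> \<psi> = (\<lambda>y\<in>cover (R i). \<phi> (\<psi> y))"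
    using assms(3,4) by (simp add: Gal_at_def mult_Gal)
  show "\<phi> \<otimes>\<^bsub>Gal_at R i\<^esub> \<psi> \<in> carrier (Gal_at R i)"
    unfolding *
    using Aut_over_compose[OF pointed_factor_shift_image[OF representative_mem(1)[OF R i]]] assms(3,4)
    by (simp add: carrier_Gal_at)
qed

text \<open>The commuting squares of \<open>g\<close> and \<open>h\<close> compose to a square for
  the product. The result supplies the closure hypothesis of \<open>H1_isomorphic\<close>.\<close>

lemma abs_galois_group_mult_closed:
  assumes X: "irreducible_sft A X" and R: "representatives X x0 R"
    and g: "g \<in> carrier (abs_galois_group X x0 R)" and h: "h \<in> carrier (abs_galois_group X x0 R)"
  shows "g \<otimes>\<^bsub>abs_galois_group X x0 R\<^esub> h \<in> carrier (abs_galois_group X x0 R)"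
proof -
  let ?I = "galois_classes X x0" and ?m = "g \<otimes>\<^bsub>abs_galois_group X x0 R\<^esub> h"
  have gi: "g i \<in> carrier (Gal_at R i)" "h i \<in> carrier (Gal_at R i)" if "i \<in> ?I" for i
    using g h that by (auto simp: carrier_abs_galois_group PiE_iff)
  have m: "?m i = (\<lambda>y\<in>cover (R i). g i (h i y))" "?m i \<in> carrier (Gal_at R i)" if "i \<in> ?I" for i
    using Gal_at_mult[OF R that gi[OF that]] that by (simp_all add: mult_abs_galois_group)
  have "restr_map R i j (?m j) = ?m i" if i: "i \<in> ?I" and j: "j \<in> ?I" and le: "class_le R i j" for i j
  proof -
    obtain \<alpha> where \<alpha>: "transition (R i) (R j) \<alpha>" using le by (auto simp: class_le_def)
    note iff = restr_map_eq_iff[OF X R i j \<alpha>]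
    have "restr_map R i j (g j) = g i" "restr_map R i j (h j) = h i"
      using g h i j le by (auto simp: carrier_abs_galois_group)
    then have eq: "g i (\<alpha> y) = \<alpha> (g j y)" "h i (\<alpha> y) = \<alpha> (h j y)" if "y \<in> cover (R j)" for y
      using iff gi i j that by auto
    have "h j y \<in> cover (R j)" if "y \<in> cover (R j)" for y
      using gi(2)[OF j] that by (auto simp: carrier_Gal_at dest: Aut_overD(6))
    then have "\<forall>y\<in>cover (R j). ?m i (\<alpha> y) = \<alpha> (?m j y)"
      using eq m(1) i j transition_code(2)[OF \<alpha>] by simp
    then show ?thesis using iff[OF m(2)[OF j] m(2)[OF i]] by blast
  qed
  moreover have "?m \<in> (\<Pi>\<^sub>E i\<in>?I. carrier (Gal_at R i))"
    using m(2) by (auto simp: PiE_iff mult_abs_galois_group)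
  ultimately show ?thesis unfolding carrier_abs_galois_group by blast
qed

lemma topspace_abs_galois_topology:
  "topspace (abs_galois_topology X x0 R) = carrier (abs_galois_group X x0 R)"
  by (auto simp: abs_galois_topology_def carrier_abs_galois_group)

text \<open>Reindexing by \<open>b\<close> and applying \<open>k i\<close> in each coordinate is an
  isomorphism and a homeomorphism of the full products. The last hypothesis says that corresponding
  families lie in \<open>C\<close> and \<open>C'\<close> together, so the map restricts to these
  subsets.\<close>

lemma product_subgroup_isomorphic:
  fixes G :: "'i \<Rightarrow> ('g, 'm) monoid_scheme" and G' :: "'j \<Rightarrow> ('h, 'n) monoid_scheme"
  assumes b: "bij_betw b I I'" and k: "\<And>i. i \<in> I \<Longrightarrow> k i \<in> iso (G i) (G' (b i))"
    and C: "C \<subseteq> (\<Pi>\<^sub>E i\<in>I. carrier (G i))" and C': "C' \<subseteq> (\<Pi>\<^sub>E i\<in>I'. carrier (G' i))"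
    and corr: "\<And>g g'. g \<in> (\<Pi>\<^sub>E i\<in>I. carrier (G i)) \<Longrightarrow> g' \<in> (\<Pi>\<^sub>E i\<in>I'. carrier (G' i)) \<Longrightarrow>
      (\<And>i. i \<in> I \<Longrightarrow> g' (b i) = k i (g i)) \<Longrightarrow> g \<in> C \<longleftrightarrow> g' \<in> C'"
  shows "top_group_isomorphic
    (product_group I G\<lparr>carrier := C\<rparr>)
    (subtopology (product_topology (\<lambda>i. discrete_topology (carrier (G i))) I) C)
    (product_group I' G'\<lparr>carrier := C'\<rparr>)
    (subtopology (product_topology (\<lambda>i. discrete_topology (carrier (G' i))) I') C')"
proof -
  let ?P = "\<Pi>\<^sub>E i\<in>I. carrier (G i)" and ?P' = "\<Pi>\<^sub>E i\<in>I'. carrier (G' i)"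
  let ?T = "product_topology (\<lambda>i. discrete_topology (carrier (G i))) I"
  let ?T' = "product_topology (\<lambda>i. discrete_topology (carrier (G' i))) I'"
  define c where "c = inv_into I b"
  have c: "c i' \<in> I" "b (c i') = i'" if "i' \<in> I'" for i'
    using b that by (auto simp: c_def bij_betw_def inv_into_into f_inv_into_f)
  have cb: "c (b i) = i" "b i \<in> I'" if "i \<in> I" for i
    using b that by (auto simp: c_def bij_betw_def)
  define l where "l i = inv_into (carrier (G i)) (k i)" for i
  have kbij: "bij_betw (k i) (carrier (G i)) (carrier (G' (b i)))"
    and khom: "k i \<in> hom (G i) (G' (b i))" if "i \<in> I" for i
    using k[OF that] by (auto simp: iso_def)
  have k_mem: "k i u \<in> carrier (G' (b i))" and lk: "l i (k i u) = u" if "i \<in> I" "u \<in> carrier (G i)" for i u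
    using kbij[OF that(1)] that(2) by (auto simp: l_def bij_betw_def)
  have l_mem: "l i v \<in> carrier (G i)" and kl: "k i (l i v) = v" if "i \<in> I" "v \<in> carrier (G' (b i))" for i v
    using kbij[OF that(1)] that(2) by (auto simp: l_def bij_betw_def inv_into_into f_inv_into_f)
  define F where "F g = (\<lambda>i'\<in>I'. k (c i') (g (c i')))" for g
  define F' where "F' g' = (\<lambda>i\<in>I. l i (g' (b i)))" for g'
  have F: "F g \<in> ?P'" if "g \<in> ?P" for g
  proof -
    have "k (c i') (g (c i')) \<in> carrier (G' i')" if "i' \<in> I'" for i'
      using k_mem[OF c(1)[OF that], of "g (c i')"] c[OF that] \<open>g \<in> ?P\<close> by (auto simp: PiE_iff)
    then show ?thesis by (simp add: F_def)
  qed
  have F': "F' g' \<in> ?P" if "g' \<in> ?P'" for g'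
    using l_mem that cb by (auto simp: F'_def PiE_iff)
  have F'F: "F' (F g) = g" if "g \<in> ?P" for g
  proof (rule extensionalityI[of _ I])
    show "F' (F g) i = g i" if "i \<in> I" for i
      using lk[OF that, of "g i"] cb[OF that] \<open>g \<in> ?P\<close> that by (simp add: F_def F'_def PiE_iff)
  qed (use that in \<open>auto simp: F'_def PiE_iff\<close>)
  have FF': "F (F' g') = g'" if "g' \<in> ?P'" for g'
  proof (rule extensionalityI[of _ I'])
    show "F (F' g') i' = g' i'" if "i' \<in> I'" for i'
      using kl[OF c(1)[OF that], of "g' i'"] c[OF that] \<open>g' \<in> ?P'\<close> that by (simp add: F_def F'_def PiE_iff)
  qed (use that in \<open>auto simp: F_def PiE_iff\<close>)
  have FC: "g \<in> C \<longleftrightarrow> F g \<in> C'" if "g \<in> ?P" for g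
    by (rule corr[OF that F[OF that]]) (simp add: F_def cb)
  \<comment> \<open>Each coordinate of \<open>F g\<close> depends on a single coordinate of
    \<open>g\<close>, through a map of discrete spaces.\<close>
  have contF: "continuous_map ?T ?T' F"
    unfolding continuous_map_componentwise
  proof (intro conjI ballI)
    show "F ` topspace ?T \<subseteq> extensional I'" by (auto simp: F_def)
    fix i' assume i': "i' \<in> I'"
    have "continuous_map ?T (discrete_topology (carrier (G' i'))) (k (c i') \<circ> (\<lambda>g. g (c i')))"
    proof (rule continuous_map_compose[OF continuous_map_product_projection[OF c(1)[OF i']]])
      show "continuous_map (discrete_topology (carrier (G (c i')))) (discrete_topology (carrier (G' i'))) (k (c i'))"
        using k_mem[OF c(1)[OF i']] c(2)[OF i'] by auto
    qed
    then show "continuous_map ?T (discrete_topology (carrier (G' i'))) (\<lambda>g. F g i')"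
      using i' by (simp add: F_def o_def)
  qed
  have contF': "continuous_map ?T' ?T F'"
    unfolding continuous_map_componentwise
  proof (intro conjI ballI)
    show "F' ` topspace ?T' \<subseteq> extensional I" by (auto simp: F'_def)
    fix i assume i: "i \<in> I"
    have "continuous_map ?T' (discrete_topology (carrier (G i))) (l i \<circ> (\<lambda>g. g (b i)))"
    proof (rule continuous_map_compose[OF continuous_map_product_projection[OF cb(2)[OF i]]])
      show "continuous_map (discrete_topology (carrier (G' (b i)))) (discrete_topology (carrier (G i))) (l i)"
        using l_mem[OF i] by auto
    qed
    then show "continuous_map ?T' (discrete_topology (carrier (G i))) (\<lambda>g. F' g i)"
      using i by (simp add: F'_def o_def)
  qed
  have "homeomorphic_maps ?T ?T' F F'"
    using contF contF' F'F FF' by (simp add: homeomorphic_maps_def)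
  then have "homeomorphic_map ?T ?T' F" by (auto simp: homeomorphic_map_maps)
  then have homeo: "homeomorphic_map (subtopology ?T C) (subtopology ?T' C') F"
    by (rule homeomorphic_map_subtopologies_alt) (simp add: FC)
  have "bij_betw F C C'"
  proof (rule bij_betw_byWitness[of _ F'])
    show "F' ` C' \<subseteq> C"
    proof clarify
      fix g' assume g': "g' \<in> C'"
      then have "g' \<in> ?P'" using C' by blast
      then show "F' g' \<in> C" using FC[OF F'] FF' g' by simp
    qed
  qed (use C C' FC FF' F'F in auto)
  moreover have "F \<in> hom (product_group I G\<lparr>carrier := C\<rparr>) (product_group I' G'\<lparr>carrier := C'\<rparr>)"
  proof (rule homI)
    fix g assume "g \<in> carrier (product_group I G\<lparr>carrier := C\<rparr>)"
    then show "F g \<in> carrier (product_group I' G'\<lparr>carrier := C'\<rparr>)" using FC C by auto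
  next
    fix g h assume "g \<in> carrier (product_group I G\<lparr>carrier := C\<rparr>)" "h \<in> carrier (product_group I G\<lparr>carrier := C\<rparr>)"
    then have gh: "g \<in> ?P" "h \<in> ?P" using C by auto
    have "k (c i') (g (c i') \<otimes>\<^bsub>G (c i')\<^esub> h (c i')) = k (c i') (g (c i')) \<otimes>\<^bsub>G' i'\<^esub> k (c i') (h (c i'))"
      if "i' \<in> I'" for i'
      using hom_mult[OF khom[OF c(1)[OF that]], of "g (c i')" "h (c i')"] c[OF that] gh
      by (simp add: PiE_iff)
    then show "F (g \<otimes>\<^bsub>product_group I G\<lparr>carrier := C\<rparr>\<^esub> h) =
        F g \<otimes>\<^bsub>product_group I' G'\<lparr>carrier := C'\<rparr>\<^esub> F h"
      using c by (simp add: F_def product_group_def cong: restrict_cong)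
  qed
  ultimately have "F \<in> iso (product_group I G\<lparr>carrier := C\<rparr>) (product_group I' G'\<lparr>carrier := C'\<rparr>)"
    by (simp add: iso_def)
  then show ?thesis using homeo unfolding top_group_isomorphic_def by blast
qed

text \<open>Precomposition with the inverse \<open>l\<close> is the map and precomposition with
  \<open>k\<close> its inverse; the vector space operations are pointwise and so are
  respected.\<close>

lemma H1_isomorphic:
  fixes G :: "('g, 'm) monoid_scheme" and H :: "('h, 'n) monoid_scheme"
  assumes iso: "top_group_isomorphic G S H T" and S: "topspace S = carrier G" and T: "topspace T = carrier H"
    and closed: "\<And>u v. u \<in> carrier G \<Longrightarrow> v \<in> carrier G \<Longrightarrow> u \<otimes>\<^bsub>G\<^esub> v \<in> carrier G"
  shows "module_isomorphic (residue_ring p) (H1 p G S) (H1 p H T)"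
proof -
  let ?Z = "residue_ring p"
  obtain k where k: "k \<in> iso G H" "homeomorphic_map S T k"
    using iso unfolding top_group_isomorphic_def by blast
  obtain l where kl: "homeomorphic_maps S T k l" using k(2) by (auto simp: homeomorphic_map_maps)
  have ck: "continuous_map S T k" and cl: "continuous_map T S l"
    and lk: "\<And>u. u \<in> carrier G \<Longrightarrow> l (k u) = u" and kl: "\<And>v. v \<in> carrier H \<Longrightarrow> k (l v) = v"
    using kl S T by (auto simp: homeomorphic_maps_def)
  have k_mem: "k u \<in> carrier H" if "u \<in> carrier G" for u
    using continuous_map_image_subset_topspace[OF ck] S T that by auto
  have l_mem: "l v \<in> carrier G" if "v \<in> carrier H" for v
    using continuous_map_image_subset_topspace[OF cl] S T that by auto
  have k_mult: "k (u \<otimes>\<^bsub>G\<^esub> v) = k u \<otimes>\<^bsub>H\<^esub> k v" if "u \<in> carrier G" "v \<in> carrier G" for u v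
    using k(1) that by (simp add: iso_def hom_mult)
  \<comment> \<open>\<open>l\<close> undoes \<open>k\<close> only on \<open>carrier G\<close>, so
    the product of the two preimages must lie there; \<open>closed\<close> guarantees it.\<close>
  have l_mult: "l (u \<otimes>\<^bsub>H\<^esub> v) = l u \<otimes>\<^bsub>G\<^esub> l v" if "u \<in> carrier H" "v \<in> carrier H" for u v
    using k_mult[OF l_mem[OF that(1)] l_mem[OF that(2)]] lk closed l_mem kl that by metis
  have H_closed: "u \<otimes>\<^bsub>H\<^esub> v \<in> carrier H" if "u \<in> carrier H" "v \<in> carrier H" for u v
    using k_mult[OF l_mem[OF that(1)] l_mem[OF that(2)]] k_mem closed l_mem kl that by metis
  define F where "F f = (\<lambda>v\<in>carrier H. f (l v))" for f :: "'g \<Rightarrow> int"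
  define F' where "F' f = (\<lambda>u\<in>carrier G. f (k u))" for f :: "'h \<Rightarrow> int"
  have F: "F f \<in> carrier (H1 p H T)" if f: "f \<in> carrier (H1 p G S)" for f
  proof -
    have fh: "f \<in> hom G (add_monoid ?Z)" and fc: "continuous_map S (discrete_topology (carrier ?Z)) f"
      using f by (auto simp: H1_def)
    have "continuous_map T (discrete_topology (carrier ?Z)) (F f)"
      by (rule continuous_map_eq[OF continuous_map_compose[OF cl fc]]) (simp add: F_def T)
    moreover have "F f \<in> hom H (add_monoid ?Z)"
    proof (rule homI)
      show "F f v \<in> carrier (add_monoid ?Z)" if "v \<in> carrier H" for v
        using fh l_mem[OF that] that by (auto simp: F_def hom_def)
      show "F f (u \<otimes>\<^bsub>H\<^esub> v) = F f u \<otimes>\<^bsub>add_monoid ?Z\<^esub> F f v" if "u \<in> carrier H" "v \<in> carrier H" for u v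
        using hom_mult[OF fh l_mem[OF that(1)] l_mem[OF that(2)]] that by (simp add: F_def H_closed l_mult)
    qed
    ultimately show ?thesis by (simp add: H1_def F_def)
  qed
  have F': "F' f \<in> carrier (H1 p G S)" if f: "f \<in> carrier (H1 p H T)" for f
  proof -
    have fh: "f \<in> hom H (add_monoid ?Z)" and fc: "continuous_map T (discrete_topology (carrier ?Z)) f"
      using f by (auto simp: H1_def)
    have "continuous_map S (discrete_topology (carrier ?Z)) (F' f)"
      by (rule continuous_map_eq[OF continuous_map_compose[OF ck fc]]) (simp add: F'_def S)
    moreover have "F' f \<in> hom G (add_monoid ?Z)"
    proof (rule homI)
      show "F' f v \<in> carrier (add_monoid ?Z)" if "v \<in> carrier G" for v
        using fh k_mem[OF that] that by (auto simp: F'_def hom_def)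
      show "F' f (u \<otimes>\<^bsub>G\<^esub> v) = F' f u \<otimes>\<^bsub>add_monoid ?Z\<^esub> F' f v" if "u \<in> carrier G" "v \<in> carrier G" for u v
        using hom_mult[OF fh k_mem[OF that(1)] k_mem[OF that(2)]] that by (simp add: F'_def closed k_mult)
    qed
    ultimately show ?thesis by (simp add: H1_def F'_def)
  qed
  have "bij_betw F (carrier (H1 p G S)) (carrier (H1 p H T))"
  proof (rule bij_betw_byWitness[of _ F'])
    show "\<forall>f\<in>carrier (H1 p G S). F' (F f) = f"
    proof
      fix f assume "f \<in> carrier (H1 p G S)"
      then have "f \<in> extensional (carrier G)" by (simp add: H1_def)
      then show "F' (F f) = f"
        by (intro extensionalityI[of _ "carrier G"]) (simp_all add: F_def F'_def k_mem lk)
    qed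
    show "\<forall>f\<in>carrier (H1 p H T). F (F' f) = f"
    proof
      fix f assume "f \<in> carrier (H1 p H T)"
      then have "f \<in> extensional (carrier H)" by (simp add: H1_def)
      then show "F (F' f) = f"
        by (intro extensionalityI[of _ "carrier H"]) (simp_all add: F_def F'_def l_mem kl)
    qed
  qed (use F F' in auto)
  moreover have "F (f \<oplus>\<^bsub>H1 p G S\<^esub> h) = F f \<oplus>\<^bsub>H1 p H T\<^esub> F h" for f h
    using l_mem by (simp add: H1_def F_def cong: restrict_cong)
  moreover have "F (a \<odot>\<^bsub>H1 p G S\<^esub> f) = a \<odot>\<^bsub>H1 p H T\<^esub> F f" for a f
    using l_mem by (simp add: H1_def F_def cong: restrict_cong)
  ultimately show ?thesis unfolding module_isomorphic_def by blast
qed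

text \<open>Since \<open>h\<close> is injective, both projections partition \<open>Y\<close> into
  the same fibres; the degree and the set of automorphisms are therefore the same.\<close>

lemma galois_factor_compose_left:
  assumes Y: "shift ` Y = Y" and X: "X \<noteq> {}" and h: "topological_conjugacy X X' h" and \<pi>: "galois_factor Y X \<pi>"
  shows "galois_factor Y X' (\<lambda>y\<in>Y. h (\<pi> y))"
proof -
  obtain d where d: "factor_map Y X \<pi>" "has_degree Y X \<pi> d" and card: "card (Aut_over Y \<pi>) = deg Y X \<pi>"
    using \<pi> by (auto simp: galois_factor_def unramified_def)
  have d': "factor_map Y X' (\<lambda>y\<in>Y. h (\<pi> y))" "has_degree Y X' (\<lambda>y\<in>Y. h (\<pi> y)) d"
    using unramified_compose_left[OF Y h d] by auto
  have "X' \<noteq> {}" using topological_conjugacyD(3)[OF h] X by blast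
  then have deg: "deg Y X' (\<lambda>y\<in>Y. h (\<pi> y)) = deg Y X \<pi>"
    using has_degree_deg[OF d'(2)] has_degree_deg[OF d(2) X] by simp
  have im: "\<pi> y \<in> X" if "y \<in> Y" for y using d(1) that by (auto simp: factor_map_def)
  have "h (\<pi> y) = h (\<pi> z) \<longleftrightarrow> \<pi> y = \<pi> z" if "y \<in> Y" "z \<in> Y" for y z
    using im topological_conjugacyD(2)[OF h] that by (auto simp: inj_on_def)
  moreover have "\<phi> y \<in> Y" if "topological_conjugacy Y Y \<phi>" "y \<in> Y" for \<phi> y
    using topological_conjugacyD(3)[OF that(1)] that(2) by blast
  ultimately have "Aut_over Y (\<lambda>y\<in>Y. h (\<pi> y)) = Aut_over Y \<pi>"
    by (auto simp: Aut_over_def)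
  then show ?thesis using d' deg card by (auto simp: galois_factor_def unramified_def)
qed

section \<open>Change of base\<close>

text \<open>The path \<open>t\<close> lives in \<open>X'\<close> and starts at \<open>h x0\<close>,
  so one correspondence handles both the conjugacy and the move of the base point.\<close>

locale conjugate_bases =
  fixes A :: "'a set" and X :: "(int \<Rightarrow> 'a) set" and x0 :: "int \<Rightarrow> 'a"
    and A' :: "'b set" and X' :: "(int \<Rightarrow> 'b) set" and x0' :: "int \<Rightarrow> 'b"
    and h :: "(int \<Rightarrow> 'a) \<Rightarrow> int \<Rightarrow> 'b" and t :: "int \<Rightarrow> 'b" and n :: int
  assumes X: "irreducible_sft A X" and X': "irreducible_sft A' X'"
    and h: "topological_conjugacy X X' h"
    and x0: "x0 \<in> X" and x0': "x0' \<in> X'" and t: "t \<in> X'"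
    and left: "left_asymptotic (h x0) t" and right: "right_asymptotic t (translate n x0')"
begin

text \<open>The covering shift is kept: over either base it is a shift on symbols from
  \<open>nat\<close>, even when the base alphabets have different types. Only the projection and the
  base point change, the latter along the lift of \<open>t\<close> through the new
  projection.\<close>

definition corr :: "'a pointed_factor \<Rightarrow> 'b pointed_factor \<Rightarrow> bool" where
  "corr c c' \<longleftrightarrow> c \<in> pointed_galois_factors X x0 \<and> c' \<in> pointed_galois_factors X' x0' \<and>
     cover c' = cover c \<and> proj c' = (\<lambda>y\<in>cover c. h (proj c y)) \<and>
     lifts_path (cover c) (proj c') t n (basept c) (basept c')"

lemma h_eq_iff: "x \<in> X \<Longrightarrow> y \<in> X \<Longrightarrow> h x = h y \<longleftrightarrow> x = y"
  using topological_conjugacyD(2)[OF h] by (auto simp: inj_on_def)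

lemma corr_left_total:
  assumes c: "c \<in> pointed_galois_factors X x0"
  shows "\<exists>c'. corr c c'"
proof -
  define Y where "Y = cover c"
  define \<pi> where "\<pi> = (\<lambda>y\<in>Y. h (proj c y))"
  obtain B where B: "irreducible_sft B Y" "galois_factor Y X (proj c)" "basept c \<in> Y" "proj c (basept c) = x0"
    using c by (auto simp: pointed_galois_factors_def Y_def)
  have inv: "shift ` Y = Y" using B(1) irreducible_sft_shift_space shift_space_shift_image by blast
  have gal: "galois_factor Y X' \<pi>"
    unfolding \<pi>_def using galois_factor_compose_left[OF inv _ h B(2)] x0 by blast
  then obtain d where "constant_to_one A' X' B Y \<pi> d"
    using X' B(1) by (auto simp: constant_to_one_def galois_factor_def unramified_def irreducible_sft_def)
  then interpret cto: constant_to_one A' X' B Y \<pi> d .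
  have "\<pi> (basept c) = h x0" using B by (simp add: \<pi>_def)
  then obtain y' where y': "y' \<in> Y" "\<pi> y' = x0'" "lifts_path Y \<pi> t n (basept c) y'"
    using cto.lifts_path_exists[OF B(3) t x0' _ right] left by auto
  then have "corr c (Y, y', \<pi>)"
    using c B(1) gal by (auto simp: corr_def pointed_galois_factors_def Y_def \<pi>_def)
  then show ?thesis by blast
qed

lemma corr_right_total:
  assumes c': "c' \<in> pointed_galois_factors X' x0'"
  shows "\<exists>c. corr c c'"
proof -
  define Y where "Y = cover c'"
  let ?l = "\<lambda>x\<in>X'. inv_into X h x"
  define \<pi> where "\<pi> = (\<lambda>y\<in>Y. ?l (proj c' y))"
  obtain B where B: "irreducible_sft B Y" "galois_factor Y X' (proj c')" "basept c' \<in> Y" "proj c' (basept c') = x0'"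
    using c' by (auto simp: pointed_galois_factors_def Y_def)
  have inv: "shift ` Y = Y" using B(1) irreducible_sft_shift_space shift_space_shift_image by blast
  have l: "topological_conjugacy X' X ?l"
    by (rule topological_conjugacy_inverse[OF irreducible_sft_shift_space[OF X] h])
  have gal: "galois_factor Y X \<pi>"
    unfolding \<pi>_def using galois_factor_compose_left[OF inv _ l B(2)] x0' by blast
  obtain d where "constant_to_one A' X' B Y (proj c') d"
    using X' B by (auto simp: constant_to_one_def galois_factor_def unramified_def irreducible_sft_def)
  then interpret cto: constant_to_one A' X' B Y "proj c'" d .
  have hX: "h ` X = X'" and hinj: "inj_on h X" using topological_conjugacyD[OF h] by auto
  then have "h x0 \<in> X'" using x0 by blast
  then obtain y where y: "y \<in> Y" "proj c' y = h x0" "lifts_path Y (proj c') t n y (basept c')"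
    using cto.lifts_path_exists_reverse[OF B(3) t _ left] right B(4) by auto
  have "\<pi> y = x0" using y hinj x0 \<open>h x0 \<in> X'\<close> by (simp add: \<pi>_def)
  \<comment> \<open>\<open>corr\<close> asks for equality of functions, so the values outside
    \<open>Y\<close> must match as well; a code is extensional.\<close>
  moreover have "proj c' = (\<lambda>y\<in>Y. h (\<pi> y))"
  proof (rule extensionalityI[of _ Y])
    show "proj c' \<in> extensional Y" using sliding_block_codeD(2)[OF cto.code] .
    show "proj c' y = (\<lambda>y\<in>Y. h (\<pi> y)) y" if "y \<in> Y" for y
      using cto.maps_to[OF that] that hX by (simp add: \<pi>_def f_inv_into_f)
  qed simp
  ultimately have "corr (Y, y, \<pi>) c'"
    using c' B(1) gal y by (auto simp: corr_def pointed_galois_factors_def Y_def)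
  then show ?thesis by blast
qed

text \<open>The same map \<open>\<alpha>\<close> serves over both bases. Injectivity of
  \<open>h\<close> makes the conditions on projections equivalent. For the base points,
  \<open>\<alpha>\<close> carries the lifted path of \<open>d\<close> to a lifted path in the cover
  of \<open>c\<close>; uniqueness at either end shows that \<open>\<alpha>\<close> respects the old
  base points exactly when it respects the new ones.\<close>

lemma corr_transition:
  assumes c: "corr c c'" and d: "corr d d'"
  shows "transition c d \<alpha> \<longleftrightarrow> transition c' d' \<alpha>"
proof (cases "unramified (cover d) (cover c) \<alpha>")
  case False
  then show ?thesis using c d by (auto simp: transition_def corr_def)
next
  case True
  have cov: "cover c' = cover c" "cover d' = cover d"
    and prj: "proj c' = (\<lambda>y\<in>cover c. h (proj c y))" "proj d' = (\<lambda>y\<in>cover d. h (proj d y))"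
    and pgf: "c \<in> pointed_galois_factors X x0" "d \<in> pointed_galois_factors X x0"
      "c' \<in> pointed_galois_factors X' x0'" "d' \<in> pointed_galois_factors X' x0'"
    and path: "lifts_path (cover c) (proj c') t n (basept c) (basept c')"
      "lifts_path (cover d) (proj d') t n (basept d) (basept d')"
    using c d unfolding corr_def by blast+
  obtain B e where C: "constant_to_one A X B (cover c) (proj c) e" "basept c \<in> cover c" "proj c (basept c) = x0"
    using pointed_galois_factorE[OF X pgf(1)] by metis
  obtain D f where D: "irreducible_sft D (cover d)" "constant_to_one A X D (cover d) (proj d) f"
      "basept d \<in> cover d" "proj d (basept d) = x0"
    using pointed_galois_factorE[OF X pgf(2)] by metis
  obtain B' e' where "constant_to_one A' X' B' (cover c') (proj c') e'" "basept c' \<in> cover c'" "proj c' (basept c') = x0'"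
    using pointed_galois_factorE[OF X' pgf(3)] by metis
  note C' = this[unfolded cov]
  have D': "basept d' \<in> cover d" "proj d' (basept d') = x0'"
    using pgf(4) cov by (auto simp: pointed_galois_factors_def)
  have \<alpha>: "sliding_block_code (cover d) (cover c) \<alpha>"
    using True by (simp add: unramified_def factor_map_def)
  have mem: "\<alpha> y \<in> cover c" if "y \<in> cover d" for y
    using sliding_block_codeD(1)[OF \<alpha> that] .
  have over: "(\<forall>y\<in>cover d. proj d y = proj c (\<alpha> y)) \<longleftrightarrow> (\<forall>y\<in>cover d. proj d' y = proj c' (\<alpha> y))"
    using mem h_eq_iff constant_to_one.maps_to[OF C(1)] constant_to_one.maps_to[OF D(2)]
    by (simp add: prj)
  have "\<alpha> (basept d) = basept c \<longleftrightarrow> \<alpha> (basept d') = basept c'"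
    if ov: "\<forall>y\<in>cover d. proj d' y = proj c' (\<alpha> y)" "\<forall>y\<in>cover d. proj d y = proj c (\<alpha> y)"
  proof -
    have *: "lifts_path (cover c) (proj c') t n (\<alpha> (basept d)) (\<alpha> (basept d'))"
      by (rule lifts_path_map[OF irreducible_sft_shift_space[OF D(1)] \<alpha> _ D(3) D'(1) path(2)]) (simp add: ov(1))
    have base: "proj c' (\<alpha> (basept d)) = proj c' (basept c)" "proj c' (\<alpha> (basept d')) = proj c' (basept c')"
      using ov C C' D D' mem by (simp_all add: prj(1)) 
    show ?thesis
    proof
      assume "\<alpha> (basept d) = basept c"
      then show "\<alpha> (basept d') = basept c'"
        using constant_to_one.lifts_path_unique[OF C'(1) _ path(1), of "\<alpha> (basept d')"] * base mem D' C' by simp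
    next
      assume "\<alpha> (basept d') = basept c'"
      then show "\<alpha> (basept d) = basept c"
        using constant_to_one.lifts_path_unique_reverse[OF C'(1) _ path(1), of "\<alpha> (basept d)"] * base mem D C by simp
    qed
  qed
  then show ?thesis using True over by (auto simp: transition_def cov)
qed

lemma corr_pointed_iso:
  assumes c: "corr c c'" and d: "corr d d'"
  shows "pointed_iso c d \<gamma> \<longleftrightarrow> pointed_iso c' d' \<gamma>"
  unfolding pointed_iso_iff_transition using corr_transition[OF d c] c d by (simp add: corr_def)

lemma corr_pointed_equiv:
  assumes c: "corr c c'" and d: "corr d d'"
  shows "(c, d) \<in> pointed_equiv X x0 \<longleftrightarrow> (c', d') \<in> pointed_equiv X' x0'"
  unfolding pointed_equiv_iff using corr_pointed_iso[OF c d] c d by (auto simp: corr_def)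

text \<open>\<open>b\<close> sends a class to that of its transported representative. Since
  \<open>corr\<close> preserves and reflects equivalence, \<open>b\<close> is injective, and
  \<open>corr_right_total\<close> makes it onto. The transported representative lies in
  \<open>b i\<close> but need not be the representative chosen there.\<close>

lemma classes_correspond:
  assumes R: "representatives X x0 R"
  shows "\<exists>b. bij_betw b (galois_classes X x0) (galois_classes X' x0') \<and>
    (\<forall>i\<in>galois_classes X x0. \<exists>c'\<in>b i. corr (R i) c')"
proof -
  let ?I = "galois_classes X x0" and ?I' = "galois_classes X' x0'"
  let ?r = "pointed_equiv X x0" and ?r' = "pointed_equiv X' x0'"
  note eq = equiv_pointed_equiv[of X x0] and eq' = equiv_pointed_equiv[of X' x0']
  note Rm = representative_mem[OF R]
  obtain \<Phi> where \<Phi>: "\<And>c. c \<in> pointed_galois_factors X x0 \<Longrightarrow> corr c (\<Phi> c)"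
    using corr_left_total by metis
  define b where "b i = ?r' `` {\<Phi> (R i)}" for i
  have m: "\<Phi> (R i) \<in> pointed_galois_factors X' x0'" if "i \<in> ?I" for i
    using \<Phi>[OF Rm(1)[OF that]] by (simp add: corr_def)
  have "inj_on b ?I"
  proof (rule inj_onI)
    fix i j assume ij: "i \<in> ?I" "j \<in> ?I" "b i = b j"
    then have "(\<Phi> (R i), \<Phi> (R j)) \<in> ?r'"
      unfolding b_def using eq_equiv_class[OF _ eq' m] by blast
    then have "(R i, R j) \<in> ?r"
      using corr_pointed_equiv[OF \<Phi>[OF Rm(1)[OF ij(1)]] \<Phi>[OF Rm(1)[OF ij(2)]]] by simp
    then show "i = j"
      using Rm(3)[OF ij(1)] Rm(3)[OF ij(2)] equiv_class_eq[OF eq] by metis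
  qed
  moreover have "b ` ?I = ?I'"
  proof
    show "b ` ?I \<subseteq> ?I'" using m by (auto simp: b_def galois_classes_def intro: quotientI)
    show "?I' \<subseteq> b ` ?I"
    proof
      fix i' assume "i' \<in> ?I'"
      then obtain c' where c': "c' \<in> pointed_galois_factors X' x0'" "i' = ?r' `` {c'}"
        unfolding galois_classes_def by (rule quotientE)
      obtain c where c: "corr c c'" using corr_right_total[OF c'(1)] by blast
      then have cX: "c \<in> pointed_galois_factors X x0" by (simp add: corr_def)
      define i where "i = ?r `` {c}"
      have i: "i \<in> ?I" using cX by (simp add: i_def galois_classes_def quotientI)
      have "(c, R i) \<in> ?r" using Rm(2)[OF i] by (simp add: i_def)
      then have "(c', \<Phi> (R i)) \<in> ?r'" using corr_pointed_equiv[OF c \<Phi>[OF Rm(1)[OF i]]] by simp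
      then have "i' = b i" unfolding c'(2) b_def by (rule equiv_class_eq[OF eq'])
      then show "i' \<in> b ` ?I" using i by blast
    qed
  qed
  moreover have "\<Phi> (R i) \<in> b i" if "i \<in> ?I" for i
    using equiv_class_self[OF eq' m[OF that]] by (simp add: b_def)
  ultimately show ?thesis
    using \<Phi> Rm(1) unfolding bij_betw_def by blast
qed

text \<open>The Galois group at \<open>i\<close> is carried to that at \<open>b i\<close> by
  conjugation with an equivalence \<open>\<gamma> i\<close> from the transported factor to the
  chosen representative. As the \<open>\<gamma> i\<close> preserve base points, they also conjugate
  transitions to transitions, and compatible threads correspond.\<close>

lemma abs_galois_group_isomorphic:
  assumes R: "representatives X x0 R" and R': "representatives X' x0' R'"
  shows "top_group_isomorphic (abs_galois_group X x0 R) (abs_galois_topology X x0 R)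
    (abs_galois_group X' x0' R') (abs_galois_topology X' x0' R')"
proof -
  let ?I = "galois_classes X x0" and ?I' = "galois_classes X' x0'"
  obtain b where b: "bij_betw b ?I ?I'" and "\<forall>i\<in>?I. \<exists>c'\<in>b i. corr (R i) c'"
    using classes_correspond[OF R] by blast
  then obtain \<Phi> where \<Phi>: "\<And>i. i \<in> ?I \<Longrightarrow> \<Phi> i \<in> b i" "\<And>i. i \<in> ?I \<Longrightarrow> corr (R i) (\<Phi> i)" by metis
  have bI: "b i \<in> ?I'" if "i \<in> ?I" for i using b that by (auto simp: bij_betw_def)
  have b_eq: "?I' = b ` ?I" using b by (simp add: bij_betw_def)
  note Rm = representative_mem[OF R] and Rm' = representative_mem[OF R' bI]
  have "\<exists>\<gamma>. pointed_iso (\<Phi> i) (R' (b i)) \<gamma>" if "i \<in> ?I" for i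
  proof -
    have "(R' (b i), \<Phi> i) \<in> pointed_equiv X' x0'"
      using \<Phi>(1)[OF that] Rm'(3)[OF that] by blast
    then have "(\<Phi> i, R' (b i)) \<in> pointed_equiv X' x0'"
      using equiv_pointed_equiv[of X' x0'] by (meson equivE symE)
    then show ?thesis by (simp add: pointed_equiv_iff)
  qed
  then obtain \<gamma> where \<gamma>: "\<And>i. i \<in> ?I \<Longrightarrow> pointed_iso (\<Phi> i) (R' (b i)) (\<gamma> i)" by metis
  define \<delta> where "\<delta> i = (\<lambda>y\<in>cover (R' (b i)). inv_into (cover (R i)) (\<gamma> i) y)" for i
  define k where "k i = (\<lambda>\<phi>. \<lambda>y\<in>cover (R' (b i)). \<gamma> i (\<phi> (inv_into (cover (R i)) (\<gamma> i) y)))" for i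
  have cov: "cover (\<Phi> i) = cover (R i)" "\<Phi> i \<in> pointed_galois_factors X' x0'" if "i \<in> ?I" for i
    using \<Phi>(2)[OF that] by (auto simp: corr_def)
  have conj: "topological_conjugacy (cover (R i)) (cover (R' (b i))) (\<gamma> i)" if "i \<in> ?I" for i
    using \<gamma>[OF that] cov[OF that] by (simp add: pointed_iso_def)
  note cj = topological_conjugacyD[OF conj]
  have \<delta>: "pointed_iso (R' (b i)) (\<Phi> i) (\<delta> i)" if "i \<in> ?I" for i
    using pointed_iso_inverse[OF cov(2) \<gamma>, OF that that] cov(1)[OF that] by (simp add: \<delta>_def)
  have \<delta>\<gamma>: "\<delta> i (\<gamma> i y) = y" "\<gamma> i y \<in> cover (R' (b i))" if "i \<in> ?I" "y \<in> cover (R i)" for i y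
    using cj(2,3)[OF that(1)] that(2) by (auto simp: \<delta>_def)
  have \<gamma>\<delta>: "\<gamma> i (\<delta> i y) = y" "\<delta> i y \<in> cover (R i)" if "i \<in> ?I" "y \<in> cover (R' (b i))" for i y
    using cj(3)[OF that(1)] that(2) by (auto simp: \<delta>_def f_inv_into_f inv_into_into)
  have k_apply: "k i \<phi> y = \<gamma> i (\<phi> (\<delta> i y))" if "y \<in> cover (R' (b i))" for i \<phi> y
    using that by (simp add: k_def \<delta>_def)
  have k: "k i \<in> iso (Gal_at R i) (Gal_at R' (b i))" if i: "i \<in> ?I" for i
  proof -
    obtain B where B: "shift_space B (cover (R i))" using pointed_factor_cover(1)[OF Rm(1)[OF i]] by blast
    obtain D e where "constant_to_one A X D (cover (R i)) (proj (R i)) e"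
      using pointed_galois_factorE[OF X Rm(1)[OF i]] by metis
    then have mem: "proj (R i) y \<in> X" if "y \<in> cover (R i)" for y
      using constant_to_one.maps_to that by blast
    \<comment> \<open>The two projections differ by the injective map \<open>h\<close>, so
      \<open>\<gamma> i\<close> respects equality of projections, as \<open>conjugation_iso\<close>
      requires.\<close>
    have "proj (R' (b i)) (\<gamma> i y) = h (proj (R i) y)" if "y \<in> cover (R i)" for y
      using \<gamma>[OF i] \<Phi>(2)[OF i] that by (simp add: pointed_iso_def corr_def)
    then show ?thesis
      unfolding k_def Gal_at_def using h_eq_iff mem by (intro conjugation_iso[OF B conj[OF i]]) simp
  qed
  have k_mem: "k i \<phi> \<in> carrier (Gal_at R' (b i))" if "i \<in> ?I" "\<phi> \<in> carrier (Gal_at R i)" for i \<phi>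
    using k[OF that(1)] that(2) by (auto simp: iso_def bij_betw_def)
  have transport: "transition (R' (b i)) (R' (b j)) (\<lambda>y\<in>cover (R' (b j)). \<gamma> i (\<alpha> (\<delta> j y)))"
    if "i \<in> ?I" "j \<in> ?I" "transition (R i) (R j) \<alpha>" for i j \<alpha>
  proof -
    have "transition (\<Phi> i) (\<Phi> j) \<alpha>" using corr_transition[OF \<Phi>(2) \<Phi>(2)] that by blast
    then show ?thesis
      using transition_conjugate[OF Rm'(1)[OF that(2)] \<gamma>[OF that(1)] \<delta>[OF that(2)]] by blast
  qed
  have transport_back: "\<exists>\<alpha>. transition (R i) (R j) \<alpha>"
    if "i \<in> ?I" "j \<in> ?I" "transition (R' (b i)) (R' (b j)) \<beta>" for i j \<beta>
  proof -
    have "transition (\<Phi> i) (\<Phi> j) (\<lambda>y\<in>cover (\<Phi> j). \<delta> i (\<beta> (\<gamma> j y)))"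
      by (rule transition_conjugate[OF cov(2)[OF that(2)] \<delta>[OF that(1)] \<gamma>[OF that(2)] that(3)])
    then show ?thesis using corr_transition[OF \<Phi>(2) \<Phi>(2)] that by blast
  qed
  have le: "class_le R' (b i) (b j) \<longleftrightarrow> class_le R i j" if "i \<in> ?I" "j \<in> ?I" for i j
    unfolding class_le_def using transport[OF that] transport_back[OF that] by blast
  have restr: "restr_map R' (b i) (b j) (k j \<phi>) = k i \<psi> \<longleftrightarrow> restr_map R i j \<phi> = \<psi>"
    if i: "i \<in> ?I" and j: "j \<in> ?I" and "class_le R i j"
      and \<phi>: "\<phi> \<in> carrier (Gal_at R j)" and \<psi>: "\<psi> \<in> carrier (Gal_at R i)" for i j \<phi> \<psi>
  proof -
    obtain \<alpha> where \<alpha>: "transition (R i) (R j) \<alpha>" using \<open>class_le R i j\<close> by (auto simp: class_le_def)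
    let ?\<alpha>' = "\<lambda>y\<in>cover (R' (b j)). \<gamma> i (\<alpha> (\<delta> j y))"
    have \<phi>m: "\<phi> y \<in> cover (R j)" if "y \<in> cover (R j)" for y
      using \<phi> that by (auto simp: carrier_Gal_at dest: Aut_overD(6))
    have \<psi>m: "\<psi> y \<in> cover (R i)" if "y \<in> cover (R i)" for y
      using \<psi> that by (auto simp: carrier_Gal_at dest: Aut_overD(6))
    note \<alpha>m = transition_code(2)[OF \<alpha>]
    have "restr_map R' (b i) (b j) (k j \<phi>) = k i \<psi> \<longleftrightarrow>
        (\<forall>y\<in>cover (R' (b j)). k i \<psi> (?\<alpha>' y) = ?\<alpha>' (k j \<phi> y))"
      by (rule restr_map_eq_iff[OF X' R' bI[OF i] bI[OF j] transport[OF i j \<alpha>] k_mem[OF j \<phi>] k_mem[OF i \<psi>]])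
    also have "\<dots> \<longleftrightarrow> (\<forall>y\<in>cover (R' (b j)). \<gamma> i (\<psi> (\<alpha> (\<delta> j y))) = \<gamma> i (\<alpha> (\<phi> (\<delta> j y))))"
      by (intro ball_cong refl) (simp add: k_apply i j \<delta>\<gamma> \<gamma>\<delta> \<phi>m \<alpha>m)
    \<comment> \<open>Both arguments of \<open>\<gamma> i\<close> lie in the cover of
      \<open>R i\<close>, where it is injective.\<close>
    also have "\<dots> \<longleftrightarrow> (\<forall>y\<in>cover (R' (b j)). \<psi> (\<alpha> (\<delta> j y)) = \<alpha> (\<phi> (\<delta> j y)))"
      using inj_onD[OF cj(2)[OF i]] \<gamma>\<delta>(2)[OF j] \<phi>m \<psi>m \<alpha>m by (metis (no_types, lifting))
    \<comment> \<open>\<open>\<delta> j\<close> maps onto the cover of \<open>R j\<close>, so its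
      values may be replaced by arbitrary points there.\<close>
    also have "\<dots> \<longleftrightarrow> (\<forall>y\<in>cover (R j). \<psi> (\<alpha> y) = \<alpha> (\<phi> y))"
      using \<gamma>\<delta>[OF j] \<delta>\<gamma>[OF j] by metis
    also have "\<dots> \<longleftrightarrow> restr_map R i j \<phi> = \<psi>"
      by (rule restr_map_eq_iff[OF X R i j \<alpha> \<phi> \<psi>, symmetric])
    finally show ?thesis .
  qed
  show ?thesis
    \<comment> \<open>The carrier inside the topology is rewritten before the group itself is
      unfolded, so that the same set appears as \<open>C\<close> in both places.\<close>
    unfolding abs_galois_topology_def carrier_abs_galois_group unfolding abs_galois_group_def
  proof (rule product_subgroup_isomorphic[where b = b and k = k, OF b])
    show "k i \<in> iso (Gal_at R i) (Gal_at R' (b i))" if "i \<in> ?I" for i by (rule k[OF that])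
    fix g g'
    assume g: "g \<in> (\<Pi>\<^sub>E i\<in>?I. carrier (Gal_at R i))" and g': "g' \<in> (\<Pi>\<^sub>E i\<in>?I'. carrier (Gal_at R' i))"
      and gg': "\<And>i. i \<in> ?I \<Longrightarrow> g' (b i) = k i (g i)"
    have "(\<forall>i\<in>?I'. \<forall>j\<in>?I'. class_le R' i j \<longrightarrow> restr_map R' i j (g' j) = g' i) \<longleftrightarrow>
      (\<forall>i\<in>?I. \<forall>j\<in>?I. class_le R i j \<longrightarrow> restr_map R i j (g j) = g i)"
      unfolding b_eq ball_simps using gg' le restr g by (simp add: PiE_iff cong: ball_cong)
    then show "g \<in> {g \<in> \<Pi>\<^sub>E i\<in>?I. carrier (Gal_at R i).
          \<forall>i\<in>?I. \<forall>j\<in>?I. class_le R i j \<longrightarrow> restr_map R i j (g j) = g i} \<longleftrightarrow>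
        g' \<in> {g \<in> \<Pi>\<^sub>E i\<in>?I'. carrier (Gal_at R' i).
          \<forall>i\<in>?I'. \<forall>j\<in>?I'. class_le R' i j \<longrightarrow> restr_map R' i j (g j) = g i}"
      using g g' by simp
  qed auto
qed

end

theorem theorem1p2:
  fixes A :: "'a set" and X :: "(int \<Rightarrow> 'a) set" and x0 :: "int \<Rightarrow> 'a" and R :: "'a representatives"
    and A' :: "'b set" and X' :: "(int \<Rightarrow> 'b) set" and x0' :: "int \<Rightarrow> 'b" and R' :: "'b representatives"
  assumes "irreducible_sft A X" and "irreducible_sft A' X'"
    and "topologically_conjugate X X'"
    and "x0 \<in> X" and "representatives X x0 R"
    and "x0' \<in> X'" and "representatives X' x0' R'"
  shows "top_group_isomorphic
           (abs_galois_group X x0 R) (abs_galois_topology X x0 R)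
           (abs_galois_group X' x0' R') (abs_galois_topology X' x0' R') \<and>
         (\<forall>p::nat. prime p \<longrightarrow>
           module_isomorphic (residue_ring (int p))
             (H1 (int p) (abs_galois_group X x0 R) (abs_galois_topology X x0 R))
             (H1 (int p) (abs_galois_group X' x0' R') (abs_galois_topology X' x0' R')))"
proof -
  obtain h where h: "topological_conjugacy X X' h"
    using assms(3) by (auto simp: topologically_conjugate_def)
  have "h x0 \<in> X'" using topological_conjugacyD(3)[OF h] assms(4) by blast
  \<comment> \<open>The path is chosen once, in the base \<open>X'\<close>, independently of all
    covers.\<close>
  then obtain t n where "t \<in> X'" "left_asymptotic (h x0) t" "right_asymptotic t (translate n x0')"
    using irreducible_connecting_point[OF assms(2) _ assms(6)] by blast
  then interpret conjugate_bases A X x0 A' X' x0' h t n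
    by unfold_locales (use assms h in auto)
  have "top_group_isomorphic
      (abs_galois_group X x0 R) (abs_galois_topology X x0 R)
      (abs_galois_group X' x0' R') (abs_galois_topology X' x0' R')"
    by (rule abs_galois_group_isomorphic[OF assms(5,7)])
  then show ?thesis
    using H1_isomorphic[OF _ topspace_abs_galois_topology topspace_abs_galois_topology
        abs_galois_group_mult_closed[OF assms(1,5)]]
    by blast
qed

end
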